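(* Let $\varepsilon>0$, $\triangle t=T/N_t$, and let $(\alpha^n)_{0\le n\le N_t}\subset\mathbb R^{N_X}$, $u_h^n=\sum_{\xi\in X}\alpha_\xi^n\chi_\xi$, satisfy for every $0\le n<N_t$ either the fully-discrete Allen–Cahn scheme $$\frac{\alpha^{n+1}-\alpha^n}{\triangle t}=-\varepsilon^2A^{-1}B\,\frac{\alpha^n+\alpha^{n+1}}2-A^{-1}\tilde\lambda_G^{n+1},$$ or (for every $n$) the fully-discrete Cahn–Hilliard scheme $$\frac{\alpha^{n+1}-\alpha^n}{\triangle t}=-\varepsilon^2A^{-1}BA^{-1}B\,\frac{\alpha^n+\alpha^{n+1}}2-A^{-1}BA^{-1}\tilde\lambda_G^{n+1}.$$ Let $$E_{d,G}^n=\frac{\varepsilon^2}{2}(\alpha^n)^TB\,\alpha^n+\langle G(u_h^n),1\rangle_{L^2(\mathcal S)}.$$ Then $E_{d,G}^n\le E_{d,G}^{n-1}$ for all $1\le n\le N_t$.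
   Context: $\mathcal S\subset\mathbb R^d$ is a closed, compact, connected, $C^\infty$ surface with surface gradient $\nabla_{\mathcal S}$, and $\langle\cdot,\cdot\rangle_{L^2(\mathcal S)}$ is the $L^2$ inner product. $G:\mathbb R\to\mathbb R$ is the free energy density, with $G'$ smooth; the paper's choice is the Ginzburg–Landau density $G(u)=\frac14(u^2-1)^2$. $X\subset\mathcal S$ is a finite set of $N_X$ distinct points; $\phi_m$ is the positive definite Matérn kernel on $\mathcal S$, the reproducing kernel of the Sobolev space $W_2^m(\mathcal S)$; $V_{X,\phi_m}=\mathrm{span}\{\phi_m(\cdot,x):x\in X\}$; $\chi_\xi\in V_{X,\phi_m}$ ($\xi\in X$) is the Lagrange function, i.e. the unique element with $\chi_\xi(\xi)=1$, $\chi_\xi(\eta)=0$ for $\eta\in X\setminus\{\xi\}$. $A=\big[\langle\chi_\xi,\chi_\eta\rangle_{L^2(\mathcal S)}\big]_{\xi,\eta\in X}$, $B=\big[\langle\nabla_{\mathcal S}\chi_\xi,\nabla_{\mathcal S}\chi_\eta\rangle_{L^2(\mathcal S)}\big]_{\xi,\eta\in X}$, and $$\tilde\lambda_G^{n+1}=\left[\left\langle\frac{G(u_h^{n+1})-G(u_h^n)}{u_h^{n+1}-u_h^n},\chi_\eta\right\rangle_{L^2(\mathcal S)}\right]_{\eta\in X}\in\mathbb R^{N_X},$$ where the difference quotient stands for $\int_0^1G'\big((1-s)u_h^n+s\,u_h^{n+1}\big)\,ds$ (so it equals $G'(u_h^n)$ at points where $u_h^{n+1}=u_h^n$). *)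

theory Defs
  imports "HOL-Analysis.Analysis"
begin

primrec Ck_on :: "nat \<Rightarrow> 'a::real_normed_vector set \<Rightarrow> ('a \<Rightarrow> 'b::real_normed_vector) \<Rightarrow> bool" where
  "Ck_on 0 U f \<longleftrightarrow> continuous_on U f"
| "Ck_on (Suc k) U f \<longleftrightarrow>
     (\<forall>x\<in>U. f differentiable (at x)) \<and> (\<forall>v. Ck_on k U (\<lambda>x. frechet_derivative f (at x) v))"

text \<open>Only used for open \<open>U\<close>, since the derivatives are taken at full neighbourhoods.\<close>

definition smooth_on :: "'a::real_normed_vector set \<Rightarrow> ('a \<Rightarrow> 'b::real_normed_vector) \<Rightarrow> bool" where
  "smooth_on U f \<longleftrightarrow> (\<forall>k. Ck_on k U f)"


subsection \<open>Closed smooth surfaces in Euclidean space and their surface measure\<close>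

text \<open>The dimension of a surface is \<open>CARD('k)\<close>, with \<open>'k\<close> passed as \<open>TYPE('k)\<close>; no codimension
  is fixed, hypersurfaces being the case \<open>CARD('k) + 1 = DIM('a)\<close>.\<close>

definition surface_chart ::
    "'a::euclidean_space set \<Rightarrow> (real ^ 'k::finite) set \<Rightarrow> (real ^ 'k \<Rightarrow> 'a) \<Rightarrow> bool" where
  "surface_chart S U \<psi> \<longleftrightarrow>
     open U \<and> smooth_on U \<psi> \<and> (\<forall>x\<in>U. inj (frechet_derivative \<psi> (at x))) \<and>
     (\<exists>\<psi>'. homeomorphism U (\<psi> ` U) \<psi> \<psi>') \<and> openin (top_of_set S) (\<psi> ` U)"

text \<open>Every point has a chart with open domain, so there is no boundary.\<close>

definition closed_smooth_surface :: "'k::finite itself \<Rightarrow> 'a::euclidean_space set \<Rightarrow> bool" where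
  "closed_smooth_surface TYPE('k) S \<longleftrightarrow>
     S \<noteq> {} \<and> compact S \<and> connected S \<and>
     (\<forall>p\<in>S. \<exists>(U :: (real ^ 'k) set) \<psi>. surface_chart S U \<psi> \<and> p \<in> \<psi> ` U)"

definition metric_tensor :: "(real ^ 'k::finite \<Rightarrow> 'a::euclidean_space) \<Rightarrow> real ^ 'k \<Rightarrow> real ^ 'k ^ 'k" where
  "metric_tensor \<psi> x =
     (\<chi> i j. frechet_derivative \<psi> (at x) (axis i 1) \<bullet> frechet_derivative \<psi> (at x) (axis j 1))"

text \<open>The surface measure is the unique Borel measure on \<open>S\<close> that equals
  \<open>sqrt (det g) dx\<close> in every chart, \<open>g\<close> being the metric induced by the ambient inner product.\<close>

definition surface_measure :: "'k::finite itself \<Rightarrow> 'a::euclidean_space set \<Rightarrow> 'a measure \<Rightarrow> bool" where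
  "surface_measure TYPE('k) S \<sigma> \<longleftrightarrow>
     sets \<sigma> = sets (restrict_space borel S) \<and>
     (\<forall>(U :: (real ^ 'k) set) \<psi>. surface_chart S U \<psi> \<longrightarrow>
        (\<forall>E\<in>sets borel. E \<subseteq> U \<longrightarrow>
           emeasure \<sigma> (\<psi> ` E) = (\<integral>\<^sup>+x\<in>E. ennreal (sqrt (det (metric_tensor \<psi> x))) \<partial>lborel)))"


subsection \<open>Calculus on a surface\<close>

definition smooth_fun_on :: "'a::euclidean_space set \<Rightarrow> ('a \<Rightarrow> real) \<Rightarrow> bool" where
  "smooth_fun_on S f \<longleftrightarrow>
     (\<forall>p\<in>S. \<exists>U F. open U \<and> p \<in> U \<and> smooth_on U F \<and> (\<forall>q\<in>S \<inter> U. F q = f q))"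

definition tangent_space :: "'a::euclidean_space set \<Rightarrow> 'a \<Rightarrow> 'a set" where
  "tangent_space S p =
     {v. \<exists>\<gamma>::real \<Rightarrow> 'a. (\<forall>t. \<gamma> t \<in> S) \<and> \<gamma> 0 = p \<and> (\<gamma> has_vector_derivative v) (at 0)}"

definition smooth_gradient :: "'a::euclidean_space set \<Rightarrow> ('a \<Rightarrow> real) \<Rightarrow> 'a \<Rightarrow> 'a" where
  "smooth_gradient S f p =
     (THE g. g \<in> tangent_space S p \<and> (f has_derivative (\<lambda>v. g \<bullet> v)) (at p within S))"

text \<open>\<open>cov_deriv S f [v\<^sub>1, \<dots>, v\<^sub>k] p\<close> is the iterated covariant derivative \<open>\<nabla>\<^sup>k f\<close> at \<open>p\<close>, evaluated at
  the tangential parts of \<open>v\<^sub>1, \<dots>, v\<^sub>k\<close>. It is obtained from the ambient derivative by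
  projecting all slots to the tangent space: for a covariant tensor \<open>T\<close> on \<open>S\<close> extended by
  \<open>T\<^sub>q(w) = T\<^sub>q(P\<^sub>q w)\<close>, and \<open>w\<close> tangent at \<open>p\<close>, the Levi-Civita derivative of \<open>q \<mapsto> P\<^sub>q w\<close> vanishes
  at \<open>p\<close>, so \<open>(\<nabla>\<^sub>v T)(w) = v(q \<mapsto> T\<^sub>q(w))\<close> there. The orthogonal projection \<open>P\<^sub>p\<close> is
  \<open>closest_point (tangent_space S p)\<close>.\<close>

fun cov_deriv :: "'a::euclidean_space set \<Rightarrow> ('a \<Rightarrow> real) \<Rightarrow> 'a list \<Rightarrow> 'a \<Rightarrow> real" where
  "cov_deriv S f [] p = f p"
| "cov_deriv S f (v # vs) p =
     smooth_gradient S (\<lambda>q. cov_deriv S f (map (closest_point (tangent_space S p)) vs) q) p \<bullet> v"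


subsection \<open>Sobolev spaces and the Matern kernel\<close>

definition square_integrable :: "'a measure \<Rightarrow> ('a \<Rightarrow> real) \<Rightarrow> bool" where
  "square_integrable \<sigma> f \<longleftrightarrow> f \<in> borel_measurable \<sigma> \<and> integrable \<sigma> (\<lambda>x. (f x)\<^sup>2)"

definition L2_inner :: "'a measure \<Rightarrow> ('a \<Rightarrow> 'b::real_inner) \<Rightarrow> ('a \<Rightarrow> 'b) \<Rightarrow> real" where
  "L2_inner \<sigma> f g = (\<integral>x. f x \<bullet> g x \<partial>\<sigma>)"

definition multi_indices :: "nat \<Rightarrow> 'a::euclidean_space list set" where
  "multi_indices m = {vs. set vs \<subseteq> Basis \<and> length vs \<le> m}"

text \<open>\<open>W\<^sub>2\<^sup>m(S)\<close> is the completion of the smooth functions in the norm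
  \<open>(\<Sum>k\<le>m. \<integral> |\<nabla>\<^sup>k f|\<^sup>2 d\<sigma>)\<^sup>1\<^sup>/\<^sup>2\<close>, realised inside \<open>L\<^sub>2(S)\<close>: \<open>D vs\<close>, for \<open>vs\<close> a list of basis vectors,
  is a component of a weak covariant derivative. \<open>D\<close> is determined by \<open>f\<close> up to null sets.\<close>

definition has_weak_cov_derivs ::
    "'a::euclidean_space set \<Rightarrow> 'a measure \<Rightarrow> nat \<Rightarrow> ('a \<Rightarrow> real) \<Rightarrow> ('a list \<Rightarrow> 'a \<Rightarrow> real) \<Rightarrow> bool" where
  "has_weak_cov_derivs S \<sigma> m f D \<longleftrightarrow>
     square_integrable \<sigma> f \<and> (AE x in \<sigma>. D [] x = f x) \<and>
     (\<forall>vs\<in>multi_indices m. square_integrable \<sigma> (D vs)) \<and>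
     (\<exists>F :: nat \<Rightarrow> 'a \<Rightarrow> real.
        (\<forall>n. smooth_fun_on S (F n)) \<and>
        (\<forall>vs\<in>multi_indices m.
           (\<lambda>n. \<integral>\<^sup>+x. ennreal ((cov_deriv S (F n) vs x - D vs x)\<^sup>2) \<partial>\<sigma>) \<longlonglongrightarrow> 0))"

definition sobolev_space :: "'a::euclidean_space set \<Rightarrow> 'a measure \<Rightarrow> nat \<Rightarrow> ('a \<Rightarrow> real) set" where
  "sobolev_space S \<sigma> m = {f. \<exists>D. has_weak_cov_derivs S \<sigma> m f D}"

definition weak_cov_deriv ::
    "'a::euclidean_space set \<Rightarrow> 'a measure \<Rightarrow> nat \<Rightarrow> ('a \<Rightarrow> real) \<Rightarrow> 'a list \<Rightarrow> 'a \<Rightarrow> real" where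
  "weak_cov_deriv S \<sigma> m f = (SOME D. has_weak_cov_derivs S \<sigma> m f D)"

definition sobolev_inner ::
    "'a::euclidean_space set \<Rightarrow> 'a measure \<Rightarrow> nat \<Rightarrow> ('a \<Rightarrow> real) \<Rightarrow> ('a \<Rightarrow> real) \<Rightarrow> real" where
  "sobolev_inner S \<sigma> m f g =
     (\<Sum>vs\<in>multi_indices m. L2_inner \<sigma> (weak_cov_deriv S \<sigma> m f vs) (weak_cov_deriv S \<sigma> m g vs))"

text \<open>The surface gradient of a function in \<open>W\<^sub>2\<^sup>1(S)\<close>; for smooth functions it agrees with
  \<^const>\<open>smooth_gradient\<close> almost everywhere.\<close>

definition surface_gradient ::
    "'a::euclidean_space set \<Rightarrow> 'a measure \<Rightarrow> ('a \<Rightarrow> real) \<Rightarrow> 'a \<Rightarrow> 'a" where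
  "surface_gradient S \<sigma> f x = (\<Sum>b\<in>Basis. weak_cov_deriv S \<sigma> 1 f [b] x *\<^sub>R b)"

text \<open>Point values refer to continuous representatives, which every class in \<open>W\<^sub>2\<^sup>m(S)\<close> has exactly
  one of when \<open>2m > dim S\<close>. Symmetry and positive definiteness of the kernel follow from the
  reproducing property.\<close>

definition matern_kernel ::
    "'a::euclidean_space set \<Rightarrow> 'a measure \<Rightarrow> nat \<Rightarrow> ('a \<Rightarrow> 'a \<Rightarrow> real) \<Rightarrow> bool" where
  "matern_kernel S \<sigma> m \<phi> \<longleftrightarrow>
     (let H = {f \<in> sobolev_space S \<sigma> m. continuous_on S f} in
        \<forall>y\<in>S. (\<lambda>x. \<phi> x y) \<in> H \<and> (\<forall>f\<in>H. sobolev_inner S \<sigma> m f (\<lambda>x. \<phi> x y) = f y))"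

text \<open>The nodes are \<open>X = range z\<close> with \<open>z\<close> injective, so vectors indexed by \<open>X\<close> are \<open>real ^ 'n\<close>.\<close>

definition kernel_space ::
    "'a set \<Rightarrow> ('a \<Rightarrow> 'a \<Rightarrow> real) \<Rightarrow> ('n::finite \<Rightarrow> 'a) \<Rightarrow> ('a \<Rightarrow> real) set" where
  "kernel_space S \<phi> z = {v. \<exists>c :: real ^ 'n. \<forall>x\<in>S. v x = (\<Sum>j\<in>UNIV. c $ j * \<phi> x (z j))}"

definition lagrange_functions ::
    "'a set \<Rightarrow> ('a \<Rightarrow> 'a \<Rightarrow> real) \<Rightarrow> ('n::finite \<Rightarrow> 'a) \<Rightarrow> ('n \<Rightarrow> 'a \<Rightarrow> real) \<Rightarrow> bool" where
  "lagrange_functions S \<phi> z lag \<longleftrightarrow>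
     (\<forall>i. lag i \<in> kernel_space S \<phi> z \<and> (\<forall>j. lag i (z j) = (if i = j then 1 else 0)))"


subsection \<open>The fully discrete schemes\<close>

definition mass_matrix :: "'a measure \<Rightarrow> ('n::finite \<Rightarrow> 'a \<Rightarrow> real) \<Rightarrow> real ^ 'n ^ 'n" where
  "mass_matrix \<sigma> lag = (\<chi> i j. L2_inner \<sigma> (lag i) (lag j))"

definition stiffness_matrix ::
    "'a::euclidean_space set \<Rightarrow> 'a measure \<Rightarrow> ('n::finite \<Rightarrow> 'a \<Rightarrow> real) \<Rightarrow> real ^ 'n ^ 'n" where
  "stiffness_matrix S \<sigma> lag =
     (\<chi> i j. L2_inner \<sigma> (surface_gradient S \<sigma> (lag i)) (surface_gradient S \<sigma> (lag j)))"

definition discrete_fun :: "('n::finite \<Rightarrow> 'a \<Rightarrow> real) \<Rightarrow> real ^ 'n \<Rightarrow> 'a \<Rightarrow> real" where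
  "discrete_fun lag a x = (\<Sum>i\<in>UNIV. a $ i * lag i x)"

text \<open>\<open>avg_slope G' a b\<close> is the difference quotient \<open>(G b - G a) / (b - a)\<close>, extended by \<open>G' a\<close> to
  \<open>b = a\<close>, where \<open>G'\<close> is the derivative of \<open>G\<close>.\<close>

definition avg_slope :: "(real \<Rightarrow> real) \<Rightarrow> real \<Rightarrow> real \<Rightarrow> real" where
  "avg_slope G' a b = integral {0..1} (\<lambda>s. G' ((1 - s) * a + s * b))"

definition nonlinear_vec ::
    "'a measure \<Rightarrow> ('n::finite \<Rightarrow> 'a \<Rightarrow> real) \<Rightarrow> (real \<Rightarrow> real) \<Rightarrow> real ^ 'n \<Rightarrow> real ^ 'n \<Rightarrow> real ^ 'n" where
  "nonlinear_vec \<sigma> lag G' a b =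
     (\<chi> i. L2_inner \<sigma> (\<lambda>x. avg_slope G' (discrete_fun lag a x) (discrete_fun lag b x)) (lag i))"

definition allen_cahn_step ::
    "'a::euclidean_space set \<Rightarrow> 'a measure \<Rightarrow> ('n::finite \<Rightarrow> 'a \<Rightarrow> real) \<Rightarrow> (real \<Rightarrow> real) \<Rightarrow> real \<Rightarrow> real
      \<Rightarrow> real ^ 'n \<Rightarrow> real ^ 'n \<Rightarrow> bool" where
  "allen_cahn_step S \<sigma> lag G' \<epsilon> dt a b \<longleftrightarrow>
     (let Ai = matrix_inv (mass_matrix \<sigma> lag); B = stiffness_matrix S \<sigma> lag in
        (b - a) /\<^sub>R dt =
          - (\<epsilon>\<^sup>2 *\<^sub>R ((Ai ** B) *v ((a + b) /\<^sub>R 2))) - Ai *v nonlinear_vec \<sigma> lag G' a b)"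

definition cahn_hilliard_step ::
    "'a::euclidean_space set \<Rightarrow> 'a measure \<Rightarrow> ('n::finite \<Rightarrow> 'a \<Rightarrow> real) \<Rightarrow> (real \<Rightarrow> real) \<Rightarrow> real \<Rightarrow> real
      \<Rightarrow> real ^ 'n \<Rightarrow> real ^ 'n \<Rightarrow> bool" where
  "cahn_hilliard_step S \<sigma> lag G' \<epsilon> dt a b \<longleftrightarrow>
     (let Ai = matrix_inv (mass_matrix \<sigma> lag); B = stiffness_matrix S \<sigma> lag in
        (b - a) /\<^sub>R dt =
          - (\<epsilon>\<^sup>2 *\<^sub>R ((Ai ** B ** Ai ** B) *v ((a + b) /\<^sub>R 2)))
          - (Ai ** B ** Ai) *v nonlinear_vec \<sigma> lag G' a b)"

definition discrete_energy ::
    "'a::euclidean_space set \<Rightarrow> 'a measure \<Rightarrow> ('n::finite \<Rightarrow> 'a \<Rightarrow> real) \<Rightarrow> (real \<Rightarrow> real) \<Rightarrow> real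
      \<Rightarrow> real ^ 'n \<Rightarrow> real" where
  "discrete_energy S \<sigma> lag G \<epsilon> a =
     \<epsilon>\<^sup>2 / 2 * (a \<bullet> (stiffness_matrix S \<sigma> lag *v a))
     + L2_inner \<sigma> (\<lambda>x. G (discrete_fun lag a x)) (\<lambda>_. 1)"

end

theory Submission
  imports Defs
begin

text \<open>Both schemes discretise gradient flows of the same energy, and the time discretisation is
  chosen so that the chain rule for the energy holds exactly. For consecutive coefficient vectors
  \<open>a\<close> and \<open>b\<close>, let \<open>w = \<epsilon>\<^sup>2 B (a + b) / 2 + \<lambda>\<close> with \<open>\<lambda>\<close> the nonlinear vector. Pairing \<open>\<lambda>\<close> with \<open>b - a\<close>
  integrates the averaged slope times the increment of the discrete function, which is the change
  of \<open>G\<close>; together with the symmetry of \<open>B\<close> this gives \<open>E(b) - E(a) = (b - a) \<bullet> w\<close>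
  (\<open>discrete_energy_increment\<close>). With \<open>y = A\<^sup>-\<^sup>1 w\<close>, the Allen--Cahn step reads \<open>b - a = - dt y\<close> and the
  energy changes by \<open>- dt (y \<bullet> A y)\<close>; the Cahn--Hilliard step reads \<open>b - a = - dt A\<^sup>-\<^sup>1 B y\<close> and
  the energy changes by \<open>- dt (y \<bullet> B y)\<close>. Both are nonpositive once \<open>A\<close> is positive definite and \<open>B\<close> is
  positive semidefinite.

  These two facts carry the analytic content. The matrix \<open>A\<close> is definite
  (\<open>mass_matrix_pos\<close>) because Lagrange functions are continuous, so their products are integrable for the
  finite surface measure, and because this measure charges every open subset of \<open>S\<close>, so that a
  combination of zero norm vanishes at the nodes. The matrix \<open>B\<close> is semidefinite
  (\<open>stiffness_matrix_nonneg\<close>) as a Gram matrix, provided that the gradients of the Lagrange functions are square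
  integrable. They are, since the Lagrange functions are combinations of kernel functions and \<open>W\<^sub>2\<^sup>1(S)\<close> is a vector
  space. That last fact requires the gradient of a smooth function on \<open>S\<close> to be well
  defined, linear and measurable, which is derived from charts: the surface is tangent to the image of the
  differential (\<open>chart_normal_derivative_zero\<close>), tangential gradients are therefore unique, and
  Cramer's rule for the metric tensor shows that they vary continuously.\<close>

section \<open>Smooth functions\<close>

lemma frechet_derivative_cong_open:
  assumes "open U" "x \<in> U" "\<And>y. y \<in> U \<Longrightarrow> f y = g y"
  shows "frechet_derivative f (at x) = frechet_derivative g (at x)"
proof -
  have "(f has_derivative D) (at x) \<longleftrightarrow> (g has_derivative D) (at x)" for D
    using has_derivative_transform_within_open[of f D x UNIV U g]
      has_derivative_transform_within_open[of g D x UNIV U f] assms by auto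
  then show ?thesis
    by (simp add: frechet_derivative_def)
qed

text \<open>Differentiability on an open set is a local property, so a formula for the derivative that holds
  only on \<open>U\<close> may be used when the derivative is itself differentiated.\<close>

lemma Ck_on_cong:
  assumes "open U" "\<And>y. y \<in> U \<Longrightarrow> f y = g y" "Ck_on k U f"
  shows "Ck_on k U g"
  using assms(2,3)
proof (induction k arbitrary: f g)
  case 0
  then show ?case by (simp cong: continuous_on_cong)
next
  case (Suc k)
  have "g differentiable (at x)" if "x \<in> U" for x
    using Suc.prems that assms(1) has_derivative_transform_within_open[of f _ x UNIV U g]
    unfolding Ck_on.simps differentiable_def by blast
  moreover have "Ck_on k U (\<lambda>x. frechet_derivative g (at x) v)" for v
  proof (rule Suc.IH)
    show "frechet_derivative f (at y) v = frechet_derivative g (at y) v" if "y \<in> U" for y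
      using frechet_derivative_cong_open[OF assms(1) that, of f g] Suc.prems(1) by simp
    show "Ck_on k U (\<lambda>x. frechet_derivative f (at x) v)"
      using Suc.prems(2) by simp
  qed
  ultimately show ?case by simp
qed

lemma Ck_on_subset:
  assumes "Ck_on k U f" "V \<subseteq> U"
  shows "Ck_on k V f"
  using assms(1)
proof (induction k arbitrary: f)
  case 0
  then show ?case using assms(2) continuous_on_subset by auto
next
  case (Suc k)
  then show ?case using assms(2) by auto
qed

lemma Ck_on_add_scaleR:
  assumes "open U" "Ck_on k U f" "Ck_on k U g"
  shows "Ck_on k U (\<lambda>x. f x + c *\<^sub>R g x)"
  using assms(2,3)
proof (induction k arbitrary: f g)
  case 0
  then show ?case by (auto intro!: continuous_intros)
next
  case (Suc k)
  have D: "((\<lambda>x. f x + c *\<^sub>R g x) has_derivative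
      (\<lambda>v. frechet_derivative f (at x) v + c *\<^sub>R frechet_derivative g (at x) v)) (at x)" if "x \<in> U" for x
    using Suc.prems that
    by (auto intro!: derivative_intros simp: frechet_derivative_works)
  have "Ck_on k U (\<lambda>x. frechet_derivative (\<lambda>x. f x + c *\<^sub>R g x) (at x) v)" for v
  proof (rule Ck_on_cong[OF assms(1)])
    show "Ck_on k U (\<lambda>x. frechet_derivative f (at x) v + c *\<^sub>R frechet_derivative g (at x) v)"
      using Suc by auto
  qed (simp add: frechet_derivative_at[OF D, symmetric])
  then show ?case using D by (auto simp: differentiable_def)
qed

lemma smooth_on_imp:
  assumes "smooth_on U f"
  shows "continuous_on U f"
    and "x \<in> U \<Longrightarrow> (f has_derivative frechet_derivative f (at x)) (at x)"
    and "continuous_on U (\<lambda>x. frechet_derivative f (at x) v)"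
proof -
  have "Ck_on 0 U f" "Ck_on 1 U f"
    using assms unfolding smooth_on_def by blast+
  then show "continuous_on U f"
    and "x \<in> U \<Longrightarrow> (f has_derivative frechet_derivative f (at x)) (at x)"
    and "continuous_on U (\<lambda>x. frechet_derivative f (at x) v)"
    by (auto simp: frechet_derivative_works)
qed

text \<open>The vector space operations are treated as the single operation \<open>f + c g\<close> throughout; together
  with the zero function it generates all finite linear combinations.\<close>

lemma smooth_fun_on_add_scale:
  assumes "smooth_fun_on S f" "smooth_fun_on S g"
  shows "smooth_fun_on S (\<lambda>x. f x + c * g x)"
  unfolding smooth_fun_on_def
proof
  fix p assume "p \<in> S"
  obtain U F where F: "open U" "p \<in> U" "smooth_on U F" "\<forall>q\<in>S \<inter> U. F q = f q"
    using assms(1) \<open>p \<in> S\<close> unfolding smooth_fun_on_def by blast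
  obtain V H where H: "open V" "p \<in> V" "smooth_on V H" "\<forall>q\<in>S \<inter> V. H q = g q"
    using assms(2) \<open>p \<in> S\<close> unfolding smooth_fun_on_def by blast
  have "smooth_on (U \<inter> V) (\<lambda>x. F x + c *\<^sub>R H x)"
    using F H Ck_on_subset[of _ U F "U \<inter> V"] Ck_on_subset[of _ V H "U \<inter> V"]
    unfolding smooth_on_def by (intro allI Ck_on_add_scaleR open_Int) blast+
  then show "\<exists>W K. open W \<and> p \<in> W \<and> smooth_on W K \<and> (\<forall>q\<in>S \<inter> W. K q = f q + c * g q)"
    using F H by (intro exI[of _ "U \<inter> V"] exI[of _ "\<lambda>x. F x + c *\<^sub>R H x"]) auto
qed

lemma smooth_fun_on_zero: "smooth_fun_on S (\<lambda>_. 0)"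
proof -
  have "Ck_on k UNIV (\<lambda>_::'a. 0::real)" for k
    by (induction k) auto
  then show ?thesis
    unfolding smooth_fun_on_def smooth_on_def by blast
qed

lemma continuous_on_locally:
  fixes f :: "'a::t2_space \<Rightarrow> 'b::topological_space"
  assumes "\<And>p. p \<in> S \<Longrightarrow> \<exists>N. openin (top_of_set S) N \<and> p \<in> N \<and> continuous_on N f"
  shows "continuous_on S f"
  unfolding continuous_on_eq_continuous_within
proof
  fix p assume "p \<in> S"
  then obtain N where N: "openin (top_of_set S) N" "p \<in> N" "continuous_on N f"
    using assms by blast
  then obtain W where W: "open W" "N = S \<inter> W"
    by (auto simp: openin_open)
  have "at p within S = at p within N"
    by (rule at_within_nhd[of p W]) (use W N in auto)
  then show "continuous (at p within S) f"
    using N by (auto simp: continuous_on_eq_continuous_within)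
qed

lemma smooth_fun_on_continuous:
  assumes "smooth_fun_on S f"
  shows "continuous_on S f"
proof (rule continuous_on_locally)
  fix p assume "p \<in> S"
  then obtain U F where F: "open U" "p \<in> U" "smooth_on U F" "\<forall>q\<in>S \<inter> U. F q = f q"
    using assms unfolding smooth_fun_on_def by blast
  have "continuous_on (S \<inter> U) f"
    using continuous_on_subset[OF smooth_on_imp(1)[OF F(3)], of "S \<inter> U"]
    by (rule continuous_on_eq[of _ F]) (auto simp: F(4))
  then show "\<exists>N. openin (top_of_set S) N \<and> p \<in> N \<and> continuous_on N f"
    using F \<open>p \<in> S\<close> by (intro exI[of _ "S \<inter> U"]) auto
qed

section \<open>Tangent spaces and gradients\<close>

lemma surface_chart_openin_image:
  fixes \<psi> :: "real ^ 'k::finite \<Rightarrow> 'a::euclidean_space"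
  assumes "surface_chart S U \<psi>" "open V" "V \<subseteq> U"
  shows "openin (top_of_set S) (\<psi> ` V)"
proof -
  obtain \<psi>' where h: "homeomorphism U (\<psi> ` U) \<psi> \<psi>'" and o: "openin (top_of_set S) (\<psi> ` U)"
    using assms(1) unfolding surface_chart_def by blast
  have "openin (top_of_set U) V"
    using assms(2,3) by (metis Int_absorb1 openin_open)
  then have "openin (top_of_set (\<psi> ` U)) (\<psi> ` V)"
    using homeomorphism_imp_open_map[OF h] by blast
  then show ?thesis using o by (rule openin_trans)
qed

text \<open>To first order, \<open>S\<close> near \<open>\<psi> x\<close> lies in the affine plane through \<open>\<psi> x\<close> spanned by the image of the
  differential \<open>L\<close>: a linear functional that kills this image varies only by
  \<open>o(\<bar>q - \<psi> x\<bar>)\<close> as \<open>q\<close> tends to \<open>\<psi> x\<close> inside \<open>S\<close>. Indeed \<open>q = \<psi> y\<close> with \<open>y\<close> close to \<open>x\<close>, because \<open>\<psi>\<close> is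
  a homeomorphism onto a relatively open set; the functional sees only the remainder
  \<open>\<psi> y - \<psi> x - L (y - x)\<close>, which is \<open>o(\<bar>y - x\<bar>)\<close>; and \<open>\<bar>y - x\<bar>\<close> is bounded by a multiple of
  \<open>\<bar>q - \<psi> x\<bar>\<close> because \<open>L\<close> is injective, hence bounded below. Everything about derivatives within \<open>S\<close>
  rests on this estimate.\<close>

lemma chart_normal_derivative_zero:
  fixes \<psi> :: "real ^ 'k::finite \<Rightarrow> 'a::euclidean_space" and h :: "'a \<Rightarrow> real"
  assumes ch: "surface_chart S U \<psi>" and x: "x \<in> U"
    and h: "bounded_linear h" and h0: "\<And>w. h (frechet_derivative \<psi> (at x) w) = 0"
  shows "(h has_derivative (\<lambda>_. 0)) (at (\<psi> x) within S)"
proof -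
  define L where "L = frechet_derivative \<psi> (at x)"
  have sm: "smooth_on U \<psi>" and oU: "open U" and "inj L"
    using ch x unfolding surface_chart_def L_def by auto
  obtain \<psi>' where hom: "homeomorphism U (\<psi> ` U) \<psi> \<psi>'" 
    using ch unfolding surface_chart_def by blast
  have der: "(\<psi> has_derivative L) (at x)"
    unfolding L_def using smooth_on_imp(2)[OF sm x] .
  then have "bounded_linear L" by (rule has_derivative_bounded_linear)
  then obtain c where c: "c > 0" "\<And>w. c * norm w \<le> norm (L w)"
    using linear_inj_bounded_below_pos[of L] \<open>inj L\<close> by (metis bounded_linear.linear mult.commute)
  obtain K where K: "K > 0" "\<And>v. norm (h v) \<le> norm v * K"
    using bounded_linear.pos_bounded[OF h] by blast
  have "\<exists>d>0. \<forall>q\<in>S. norm (q - \<psi> x) < d \<longrightarrow> norm (h q - h (\<psi> x) - 0) \<le> e * norm (q - \<psi> x)" if "e > 0" for e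
  proof -
    \<comment> \<open>The bound \<open>e' \<le> c / 2\<close> keeps \<open>c / 2\<close> as a lower bound for the chart's expansion after the
      remainder is subtracted; the other bound absorbs the norm \<open>K\<close> of the functional.\<close>
    define e' where "e' = min (c / 2) (e * c / (2 * K))"
    have e': "e' > 0" "e' \<le> c / 2" "K * e' \<le> e * (c / 2)"
      using c(1) K(1) that by (auto simp: e'_def min_def field_simps)
    obtain d where d: "d > 0" "\<And>y. norm (y - x) < d \<Longrightarrow> norm (\<psi> y - \<psi> x - L (y - x)) \<le> e' * norm (y - x)"
      using der e'(1) unfolding has_derivative_at_alt by blast
    have "openin (top_of_set S) (\<psi> ` (U \<inter> ball x d))"
      by (rule surface_chart_openin_image[OF ch]) (use oU in auto)
    then obtain W where W: "open W" "\<psi> ` (U \<inter> ball x d) = S \<inter> W"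
      by (auto simp: openin_open)
    have "\<psi> x \<in> W" using W(2) x d(1) by auto
    then obtain r where r: "r > 0" "ball (\<psi> x) r \<subseteq> W"
      using W(1) open_contains_ball by blast
    have "norm (h q - h (\<psi> x) - 0) \<le> e * norm (q - \<psi> x)" if q: "q \<in> S" "norm (q - \<psi> x) < r" for q
    proof -
      have "q \<in> S \<inter> W"
        using q r(2) by (auto simp: subset_iff dist_norm norm_minus_commute)
      then obtain y where y: "q = \<psi> y" "y \<in> U" "norm (y - x) < d"
        using W(2) by (metis (no_types, lifting) IntD1 IntD2 dist_norm imageE mem_ball norm_minus_commute)
      let ?r = "\<psi> y - \<psi> x - L (y - x)"
      have rr: "norm ?r \<le> e' * norm (y - x)" using d(2) y(3) by blast
      have "norm (L (y - x)) \<le> norm (\<psi> y - \<psi> x) + norm ?r"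
        using norm_triangle_ineq4[of "\<psi> y - \<psi> x" ?r] by simp
      then have "c * norm (y - x) \<le> norm (\<psi> y - \<psi> x) + c / 2 * norm (y - x)"
        using c(2)[of "y - x"] rr mult_right_mono[OF e'(2), of "norm (y - x)"] by auto
      then have yx: "c / 2 * norm (y - x) \<le> norm (\<psi> y - \<psi> x)"
        by (simp add: field_simps)
      interpret h: bounded_linear h by (rule h)
      have "h q - h (\<psi> x) = h ?r"
        using h0[of "y - x"] by (simp add: y(1) L_def h.diff)
      then have "norm (h q - h (\<psi> x) - 0) \<le> norm ?r * K" using K(2) by simp
      also have "\<dots> \<le> (e' * norm (y - x)) * K" using rr K(1) by simp
      also have "\<dots> = (K * e') * norm (y - x)" by simp
      also have "\<dots> \<le> (e * (c / 2)) * norm (y - x)" using e'(3) by (rule mult_right_mono) simp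
      also have "\<dots> \<le> e * norm (q - \<psi> x)" using yx \<open>e > 0\<close> y(1) by simp
      finally show ?thesis .
    qed
    then show ?thesis using r(1) by blast
  qed
  then show ?thesis unfolding has_derivative_within_alt by simp
qed

text \<open>A straight line through \<open>x\<close> is pushed forward by the chart. The curves that define the tangent
  space are defined for all times, so outside the chart domain the curve is set to the constant \<open>\<psi> x\<close>.\<close>

lemma chart_curve_tangent:
  fixes \<psi> :: "real ^ 'k::finite \<Rightarrow> 'a::euclidean_space"
  assumes ch: "surface_chart S U \<psi>" and x: "x \<in> U"
  shows "frechet_derivative \<psi> (at x) w \<in> tangent_space S (\<psi> x)"
proof -
  have sm: "smooth_on U \<psi>" and oU: "open U" and sub: "\<psi> ` U \<subseteq> S"
    using ch openin_imp_subset unfolding surface_chart_def by blast+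
  define \<gamma> where "\<gamma> t = (if x + t *\<^sub>R w \<in> U then \<psi> (x + t *\<^sub>R w) else \<psi> x)" for t
  have "\<gamma> t \<in> S" for t using sub x by (auto simp: \<gamma>_def)
  moreover have "\<gamma> 0 = \<psi> x" by (simp add: \<gamma>_def)
  moreover have "(\<gamma> has_vector_derivative frechet_derivative \<psi> (at x) w) (at 0)"
  proof -
    have "((\<lambda>t. x + t *\<^sub>R w) has_vector_derivative w) (at 0)"
      by (auto intro!: derivative_eq_intros)
    moreover have "(\<psi> has_derivative frechet_derivative \<psi> (at x)) (at (x + 0 *\<^sub>R w))"
      using smooth_on_imp(2)[OF sm x] by simp
    ultimately have 1: "((\<lambda>t. \<psi> (x + t *\<^sub>R w)) has_vector_derivative frechet_derivative \<psi> (at x) w) (at 0)"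
      using vector_derivative_diff_chain_within[of "\<lambda>t. x + t *\<^sub>R w" w 0 UNIV \<psi> "frechet_derivative \<psi> (at x)"]
      by (simp add: o_def has_derivative_at_withinI)
    have 2: "open ((\<lambda>t. x + t *\<^sub>R w) -` U)"
      by (rule open_vimage[OF oU]) (intro continuous_intros)
    show ?thesis
      by (rule has_vector_derivative_transform_within_open[OF 1 2]) (use x in \<open>auto simp: \<gamma>_def\<close>)
  qed
  ultimately show ?thesis unfolding tangent_space_def by blast
qed

lemma chain_tangent_curve:
  fixes f :: "'a::euclidean_space \<Rightarrow> real"
  assumes "\<forall>t. \<gamma> t \<in> S" "\<gamma> 0 = p" "(\<gamma> has_vector_derivative v) (at 0)" "(f has_derivative D) (at p within S)"
  shows "((\<lambda>t. f (\<gamma> t)) has_vector_derivative D v) (at 0)"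
proof -
  have "(f has_derivative D) (at (\<gamma> 0) within range \<gamma>)"
    using assms has_derivative_subset by (metis image_subsetI)
  then show ?thesis
    using vector_derivative_diff_chain_within[OF assms(3)] by (simp add: o_def)
qed

text \<open>For the inclusion from left to right, let \<open>n\<close> be the part of the velocity \<open>v\<close> that is normal to the
  image of the differential. The functional \<open>n \<bullet> q\<close> has derivative zero within \<open>S\<close>, but also derivative
  \<open>n \<bullet> v\<close> along the curve, so \<open>n \<bullet> v = n \<bullet> n = 0\<close>.\<close>

lemma tangent_space_chart:
  fixes \<psi> :: "real ^ 'k::finite \<Rightarrow> 'a::euclidean_space"
  assumes ch: "surface_chart S U \<psi>" and x: "x \<in> U"
  shows "tangent_space S (\<psi> x) = range (frechet_derivative \<psi> (at x))"
proof
  let ?L = "frechet_derivative \<psi> (at x)"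
  show "range ?L \<subseteq> tangent_space S (\<psi> x)"
    using chart_curve_tangent[OF assms] by blast
  have "linear ?L"
    using ch x smooth_on_imp(2) has_derivative_linear unfolding surface_chart_def by blast
  then have sub: "subspace (range ?L)"
    using linear_subspace_image subspace_UNIV by blast
  show "tangent_space S (\<psi> x) \<subseteq> range ?L"
  proof
    fix v assume "v \<in> tangent_space S (\<psi> x)"
    then obtain \<gamma> where \<gamma>: "\<forall>t. \<gamma> t \<in> S" "\<gamma> 0 = \<psi> x" "(\<gamma> has_vector_derivative v) (at 0)"
      unfolding tangent_space_def by blast
    obtain t n where tn: "t \<in> span (range ?L)" "\<And>w. w \<in> span (range ?L) \<Longrightarrow> orthogonal n w" "v = t + n"
      using orthogonal_subspace_decomp_exists by metis
    have "((\<lambda>q. n \<bullet> q) has_derivative (\<lambda>_. 0)) (at (\<psi> x) within S)"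
    proof (rule chart_normal_derivative_zero[OF assms])
      show "n \<bullet> ?L w = 0" for w
        using tn(2)[of "?L w"] by (simp add: orthogonal_def span_base)
    qed (rule bounded_linear_inner_right)
    from chain_tangent_curve[OF \<gamma> this]
    have "((\<lambda>s. n \<bullet> \<gamma> s) has_vector_derivative 0) (at 0)" .
    moreover have "((\<lambda>q. n \<bullet> q) has_derivative (\<lambda>q. n \<bullet> q)) (at (\<psi> x) within S)"
      by (auto intro!: derivative_eq_intros)
    from chain_tangent_curve[OF \<gamma> this]
    have "((\<lambda>s. n \<bullet> \<gamma> s) has_vector_derivative n \<bullet> v) (at 0)" .
    ultimately have "n \<bullet> v = 0" using vector_derivative_unique_at by blast
    moreover have "n \<bullet> t = 0" using tn(1,2) by (simp add: orthogonal_def)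
    ultimately have "n = 0" by (simp add: tn(3) inner_add_right)
    then show "v \<in> range ?L" using tn(1,3) span_eq_iff[THEN iffD2, OF sub] by simp
  qed
qed

lemma tangent_space_subspace:
  assumes "closed_smooth_surface TYPE('k::finite) S" "p \<in> S"
  shows "subspace (tangent_space S p)"
proof -
  obtain U and \<psi> :: "real ^ 'k \<Rightarrow> 'a" and x where ch: "surface_chart S U \<psi>" and x: "x \<in> U" "p = \<psi> x"
    using assms unfolding closed_smooth_surface_def by blast
  have "linear (frechet_derivative \<psi> (at x))"
    using ch x smooth_on_imp(2) has_derivative_linear unfolding surface_chart_def by blast
  then show ?thesis
    using linear_subspace_image subspace_UNIV tangent_space_chart[OF ch x(1)] x(2) by metis
qed

text \<open>Derivatives within \<open>S\<close> are not unique as linear maps, but tangent curves determine them on the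
  tangent space. As the tangent space is a subspace, it contains the difference of two
  candidates for the gradient, which is therefore orthogonal to itself.\<close>

lemma smooth_gradient_eqI:
  assumes "closed_smooth_surface TYPE('k::finite) S" "p \<in> S"
    and "g \<in> tangent_space S p" "(f has_derivative (\<lambda>v. g \<bullet> v)) (at p within S)"
  shows "smooth_gradient S f p = g"
  unfolding smooth_gradient_def
proof (rule the_equality)
  fix g' assume g': "g' \<in> tangent_space S p \<and> (f has_derivative (\<lambda>v. g' \<bullet> v)) (at p within S)"
  have "g' - g \<in> tangent_space S p"
    using tangent_space_subspace[OF assms(1,2)] assms(3) g' subspace_diff by blast
  then obtain \<gamma> where \<gamma>: "\<forall>t. \<gamma> t \<in> S" "\<gamma> 0 = p" "(\<gamma> has_vector_derivative (g' - g)) (at 0)"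
    unfolding tangent_space_def by blast
  have "g' \<bullet> (g' - g) = g \<bullet> (g' - g)"
    using chain_tangent_curve[OF \<gamma>] g' assms(4) vector_derivative_unique_at by blast
  then have "(g' - g) \<bullet> (g' - g) = 0" by (simp add: inner_diff_left)
  then show "g' = g" by simp
qed (use assms in auto)

text \<open>The gradient exists: it is the tangential part of the gradient \<open>a\<close> of a local smooth extension.
  Dropping the normal part of \<open>a\<close> does not affect the derivative within \<open>S\<close>, since the normal
  part has derivative zero there.\<close>

lemma smooth_gradient_works:
  assumes S: "closed_smooth_surface TYPE('k::finite) S" "p \<in> S" and f: "smooth_fun_on S f"
  shows "smooth_gradient S f p \<in> tangent_space S p"
    and "(f has_derivative (\<lambda>v. smooth_gradient S f p \<bullet> v)) (at p within S)"
proof -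
  obtain U and \<psi> :: "real ^ 'k \<Rightarrow> 'a" and x where ch: "surface_chart S U \<psi>" and x: "x \<in> U" "p = \<psi> x"
    using S unfolding closed_smooth_surface_def by blast
  obtain V F where F: "open V" "p \<in> V" "smooth_on V F" "\<forall>q\<in>S \<inter> V. F q = f q"
    using f S(2) unfolding smooth_fun_on_def by blast
  let ?F' = "frechet_derivative F (at p)"
  have F': "(F has_derivative ?F') (at p)" using smooth_on_imp(2) F by blast
  define a where "a = adjoint ?F' 1"
  have a: "?F' v = a \<bullet> v" for v
    using adjoint_works[OF has_derivative_linear[OF F'], where x = v and y = "1::real"]
    by (simp add: a_def inner_commute)
  obtain g n where gn: "g \<in> span (tangent_space S p)"
      "\<And>w. w \<in> span (tangent_space S p) \<Longrightarrow> orthogonal n w" "a = g + n"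
    using orthogonal_subspace_decomp_exists by metis
  have g: "g \<in> tangent_space S p"
    using gn(1) span_eq_iff[THEN iffD2, OF tangent_space_subspace[OF S]] by simp
  have "((\<lambda>q. n \<bullet> q) has_derivative (\<lambda>_. 0)) (at p within S)"
    unfolding x(2)
  proof (rule chart_normal_derivative_zero[OF ch x(1)])
    show "n \<bullet> frechet_derivative \<psi> (at x) w = 0" for w
      using gn(2)[of "frechet_derivative \<psi> (at x) w"] chart_curve_tangent[OF ch x(1), of w] x(2)
      by (simp add: orthogonal_def span_base)
  qed (rule bounded_linear_inner_right)
  moreover have "((\<lambda>q. F q - n \<bullet> q) has_derivative (\<lambda>v. a \<bullet> v - n \<bullet> v)) (at p within S)"
    using has_derivative_at_withinI[OF F'] unfolding a
    by (auto intro!: derivative_eq_intros)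
  ultimately have "((\<lambda>q. (F q - n \<bullet> q) + n \<bullet> q) has_derivative (\<lambda>v. (a \<bullet> v - n \<bullet> v) + 0)) (at p within S)"
    using has_derivative_add by blast
  then have Fd: "(F has_derivative (\<lambda>v. g \<bullet> v)) (at p within S)"
    by (simp add: gn(3) inner_add_left)
  obtain d where d: "d > 0" "ball p d \<subseteq> V"
    using F(1,2) open_contains_ball by blast
  have fd: "(f has_derivative (\<lambda>v. g \<bullet> v)) (at p within S)"
    by (rule has_derivative_transform_within[OF Fd d(1) S(2)])
      (use S(2) F(4) d(2) in \<open>auto simp: subset_iff dist_commute\<close>)
  have "smooth_gradient S f p = g"
    by (rule smooth_gradient_eqI[OF S g fd])
  then show "smooth_gradient S f p \<in> tangent_space S p"
    and "(f has_derivative (\<lambda>v. smooth_gradient S f p \<bullet> v)) (at p within S)"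
    using g fd by simp_all
qed

lemma smooth_gradient_add_scale:
  assumes S: "closed_smooth_surface TYPE('k::finite) S" "p \<in> S" and f: "smooth_fun_on S f" "smooth_fun_on S g"
  shows "smooth_gradient S (\<lambda>x. f x + c * g x) p = smooth_gradient S f p + c *\<^sub>R smooth_gradient S g p"
proof (rule smooth_gradient_eqI[OF S])
  show "smooth_gradient S f p + c *\<^sub>R smooth_gradient S g p \<in> tangent_space S p"
    by (intro subspace_add subspace_scale tangent_space_subspace[OF S] smooth_gradient_works[OF S] f)
  show "((\<lambda>x. f x + c * g x) has_derivative
      (\<lambda>v. (smooth_gradient S f p + c *\<^sub>R smooth_gradient S g p) \<bullet> v)) (at p within S)"
    using smooth_gradient_works(2)[OF S f(1)] smooth_gradient_works(2)[OF S f(2)]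
    by (auto intro!: derivative_eq_intros simp: inner_add_left)
qed

lemma smooth_gradient_zero:
  assumes S: "closed_smooth_surface TYPE('k::finite) S" "p \<in> S"
  shows "smooth_gradient S (\<lambda>x. 0) p = 0"
  by (rule smooth_gradient_eqI[OF S]) (use tangent_space_subspace[OF S] in \<open>auto simp: subspace_0\<close>)

section \<open>The metric tensor\<close>

lemma pos_def_invertible:
  fixes A :: "real ^ 'n ^ 'n"
  assumes "\<And>v. v \<noteq> 0 \<Longrightarrow> v \<bullet> (A *v v) > 0"
  shows "invertible A"
proof -
  have "inj ((*v) A)"
  proof (rule injI)
    fix x y assume "A *v x = A *v y"
    then have "A *v (x - y) = 0" by (simp add: matrix_vector_mult_diff_distrib)
    then have "(x - y) \<bullet> (A *v (x - y)) = 0" by simp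
    then show "x = y" using assms[of "x - y"] by fastforce
  qed
  then show ?thesis
    by (simp add: invertible_left_inverse matrix_left_invertible_injective)
qed

text \<open>The determinant cannot change sign along the segment from the identity to \<open>A\<close>, as all matrices on
  it are positive definite and hence invertible.\<close>

lemma pos_def_det_pos:
  fixes A :: "real ^ 'n ^ 'n"
  assumes "\<And>v. v \<noteq> 0 \<Longrightarrow> v \<bullet> (A *v v) > 0"
  shows "det A > 0"
proof (rule ccontr)
  assume "\<not> det A > 0"
  define N where "N t = (\<chi> i j. (1 - t) * (mat 1 :: real ^ 'n ^ 'n) $ i $ j + t * A $ i $ j)" for t
  have N: "N t *v v = (1 - t) *\<^sub>R v + t *\<^sub>R (A *v v)" for t v
  proof -
    have "N t = (1 - t) *\<^sub>R mat 1 + t *\<^sub>R A"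
      by (simp add: N_def vec_eq_iff)
    then show ?thesis
      by (simp add: matrix_vector_mult_add_rdistrib scaleR_matrix_vector_assoc[symmetric])
  qed
  have "N 1 = A" "N 0 = mat 1" by (simp_all add: N_def vec_eq_iff)
  have "continuous_on {0..1} (\<lambda>t. det (N t))"
    unfolding det_def N_def by (simp, intro continuous_intros)
  then obtain t where t: "0 \<le> t" "t \<le> 1" "det (N t) = 0"
    using IVT2'[of "\<lambda>t. det (N t)" 1 0 0] \<open>\<not> det A > 0\<close> \<open>N 1 = A\<close> \<open>N 0 = mat 1\<close> by auto
  have "v \<bullet> (N t *v v) > 0" if "v \<noteq> 0" for v
  proof (cases "t = 0")
    case False
    have "(1 - t) * (v \<bullet> v) \<ge> 0" using t by simp
    moreover have "t * (v \<bullet> (A *v v)) > 0" using assms[OF that] t False by simp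
    ultimately show ?thesis unfolding N inner_add_right inner_scaleR_right by linarith
  qed (use that N in auto)
  then show False
    using pos_def_invertible[of "N t"] t(3) invertible_det_nz by blast
qed

lemma frechet_derivative_chart_expand:
  fixes \<psi> :: "real ^ 'k::finite \<Rightarrow> 'a::euclidean_space"
  assumes "surface_chart S U \<psi>" "x \<in> U"
  shows "frechet_derivative \<psi> (at x) w = (\<Sum>i\<in>UNIV. w $ i *\<^sub>R frechet_derivative \<psi> (at x) (axis i 1))"
proof -
  interpret L: linear "frechet_derivative \<psi> (at x)"
    using assms smooth_on_imp(2) has_derivative_linear unfolding surface_chart_def by blast
  have "w = (\<Sum>i\<in>UNIV. w $ i *\<^sub>R axis i 1)"
    using basis_expansion[of w] by (simp add: scalar_mult_eq_scaleR)
  then show ?thesis by (metis (no_types, lifting) L.scaleR L.sum sum.cong)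
qed

text \<open>The matrix applied to \<open>w\<close> tests the tangent vector with coordinates \<open>w\<close> against the coordinate
  vectors. This gives both positive definiteness and, read as a linear system, the coordinates of a
  gradient.\<close>

lemma metric_tensor_mult:
  fixes \<psi> :: "real ^ 'k::finite \<Rightarrow> 'a::euclidean_space"
  assumes "surface_chart S U \<psi>" "x \<in> U"
  shows "(metric_tensor \<psi> x *v w) $ i = frechet_derivative \<psi> (at x) (axis i 1) \<bullet> frechet_derivative \<psi> (at x) w"
  unfolding frechet_derivative_chart_expand[OF assms, of w]
  by (simp add: metric_tensor_def matrix_vector_mult_def inner_sum_right mult.commute)

lemma det_metric_tensor_pos:
  fixes \<psi> :: "real ^ 'k::finite \<Rightarrow> 'a::euclidean_space"
  assumes ch: "surface_chart S U \<psi>" "x \<in> U"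
  shows "det (metric_tensor \<psi> x) > 0"
proof (rule pos_def_det_pos)
  fix v :: "real ^ 'k" assume "v \<noteq> 0"
  let ?L = "frechet_derivative \<psi> (at x)"
  have "v \<bullet> (metric_tensor \<psi> x *v v) = (\<Sum>i\<in>UNIV. v $ i *\<^sub>R ?L (axis i 1)) \<bullet> ?L v"
    unfolding inner_vec_def metric_tensor_mult[OF assms] inner_sum_left by simp
  also have "\<dots> = ?L v \<bullet> ?L v"
    using frechet_derivative_chart_expand[OF assms, of v] by simp
  also have "\<dots> > 0"
  proof -
    have "linear ?L" "inj ?L"
      using ch smooth_on_imp(2) has_derivative_linear unfolding surface_chart_def by blast+
    then have "?L v \<noteq> 0" using \<open>v \<noteq> 0\<close> linear_injective_0 by blast
    then show ?thesis by simp
  qed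
  finally show "v \<bullet> (metric_tensor \<psi> x *v v) > 0" .
qed

lemma continuous_on_metric_tensor:
  fixes \<psi> :: "real ^ 'k::finite \<Rightarrow> 'a::euclidean_space"
  assumes "surface_chart S U \<psi>"
  shows "continuous_on U (\<lambda>x. metric_tensor \<psi> x $ i $ j)"
  using assms smooth_on_imp(3) unfolding metric_tensor_def surface_chart_def
  by (auto intro!: continuous_intros)

lemma continuous_on_det_metric_tensor:
  fixes \<psi> :: "real ^ 'k::finite \<Rightarrow> 'a::euclidean_space"
  assumes "surface_chart S U \<psi>"
  shows "continuous_on U (\<lambda>x. det (metric_tensor \<psi> x))"
  unfolding det_def by (intro continuous_intros continuous_on_metric_tensor[OF assms])

section \<open>The surface measure\<close>

lemma surface_measure_space: "surface_measure TYPE('k::finite) S \<sigma> \<Longrightarrow> space \<sigma> = S"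
  using sets_eq_imp_space_eq[of \<sigma> "restrict_space borel S"]
  by (auto simp: surface_measure_def space_restrict_space)

lemma surface_measure_continuous_measurable:
  assumes "surface_measure TYPE('k::finite) S \<sigma>" "continuous_on S f"
  shows "f \<in> borel_measurable \<sigma>"
  using borel_measurable_continuous_on_restrict[OF assms(2)] assms(1) 
    measurable_cong_sets[of \<sigma> "restrict_space borel S" borel borel]
  unfolding surface_measure_def by auto

text \<open>Near a point of the parameter domain the density \<open>sqrt (det g)\<close> lies between two positive
  constants, so small neighbourhoods on the surface have positive and finite measure.\<close>

lemma surface_measure_small_ball:
  fixes \<psi> :: "real ^ 'k::finite \<Rightarrow> 'a::euclidean_space"
  assumes \<sigma>: "surface_measure TYPE('k) S \<sigma>" and ch: "surface_chart S U \<psi>"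
    and x: "x \<in> U" and W: "open W" "\<psi> x \<in> W"
  obtains V where "openin (top_of_set S) V" "\<psi> x \<in> V" "V \<subseteq> W" "0 < emeasure \<sigma> V" "emeasure \<sigma> V < \<infinity>"
proof -
  have sm: "smooth_on U \<psi>" and oU: "open U" using ch unfolding surface_chart_def by auto
  have "open (U \<inter> \<psi> -` W)"
    by (rule continuous_open_preimage[OF smooth_on_imp(1)[OF sm] oU W(1)])
  then obtain r where r: "r > 0" "cball x r \<subseteq> U \<inter> \<psi> -` W"
    using x W(2) open_contains_cball by (metis IntI vimageI)
  let ?h = "\<lambda>y. sqrt (det (metric_tensor \<psi> y))"
  have "continuous_on (cball x r) ?h"
    by (rule continuous_on_subset[of U])
      (use r continuous_on_det_metric_tensor[OF ch] in \<open>auto intro!: continuous_intros\<close>)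
  then obtain lo hi where lo: "lo \<in> cball x r" "\<And>y. y \<in> cball x r \<Longrightarrow> ?h lo \<le> ?h y"
    and hi: "\<And>y. y \<in> cball x r \<Longrightarrow> ?h y \<le> ?h hi"
    using continuous_attains_inf[of "cball x r" ?h] continuous_attains_sup[of "cball x r" ?h] r(1)
    by (metis cball_eq_empty compact_cball not_less_iff_gr_or_eq)
  have lo0: "?h lo > 0" using det_metric_tensor_pos[OF ch, of lo] lo(1) r(2) by auto
  have em: "emeasure \<sigma> (\<psi> ` ball x r) = (\<integral>\<^sup>+y\<in>ball x r. ennreal (?h y) \<partial>lborel)"
    using \<sigma> ch r unfolding surface_measure_def by (meson ball_subset_cball borel_open le_inf_iff open_ball order_trans)
  have "0 < ennreal (?h lo) * emeasure lborel (ball x r)"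
    using lo0 r(1) content_ball_pos[of r x] by (simp add: ennreal_zero_less_mult_iff emeasure_ball)
  also have "\<dots> = (\<integral>\<^sup>+y\<in>ball x r. ennreal (?h lo) \<partial>lborel)"
    by (simp add: nn_integral_cmult_indicator)
  also have "\<dots> \<le> emeasure \<sigma> (\<psi> ` ball x r)"
    unfolding em by (rule nn_integral_mono) (auto simp: indicator_def intro!: ennreal_leI lo(2))
  finally have pos: "0 < emeasure \<sigma> (\<psi> ` ball x r)" .
  have "emeasure \<sigma> (\<psi> ` ball x r) \<le> (\<integral>\<^sup>+y\<in>ball x r. ennreal (?h hi) \<partial>lborel)"
    unfolding em by (rule nn_integral_mono) (auto simp: indicator_def intro!: ennreal_leI hi)
  also have "\<dots> = ennreal (?h hi) * emeasure lborel (ball x r)"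
    by (simp add: nn_integral_cmult_indicator)
  also have "\<dots> < \<infinity>"
    using emeasure_lborel_ball_finite[of x r] by (simp add: ennreal_mult_less_top)
  finally have fin: "emeasure \<sigma> (\<psi> ` ball x r) < \<infinity>" .
  show ?thesis
  proof (rule that[OF _ _ _ pos fin])
    show "openin (top_of_set S) (\<psi> ` ball x r)"
      by (rule surface_chart_openin_image[OF ch]) (use r ball_subset_cball in auto)
    show "\<psi> x \<in> \<psi> ` ball x r" using r(1) by simp
    show "\<psi> ` ball x r \<subseteq> W" using r(2) ball_subset_cball[of x r] by blast
  qed
qed

lemma surface_measure_openin_sets:
  assumes "surface_measure TYPE('k::finite) S \<sigma>" "openin (top_of_set S) V"
  shows "V \<in> sets \<sigma>"
  using assms unfolding surface_measure_def by (auto simp: openin_open sets_restrict_space)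

lemma surface_measure_finite:
  fixes S :: "'a::euclidean_space set"
  assumes S: "closed_smooth_surface TYPE('k::finite) S" and \<sigma>: "surface_measure TYPE('k) S \<sigma>"
  shows "finite_measure \<sigma>"
proof
  have "\<exists>V. openin (top_of_set S) V \<and> p \<in> V \<and> emeasure \<sigma> V < \<infinity>" if p: "p \<in> S" for p
  proof -
    obtain U and \<psi> :: "real ^ 'k \<Rightarrow> 'a" and x where "surface_chart S U \<psi>" "x \<in> U" "p = \<psi> x"
      using S p unfolding closed_smooth_surface_def by blast
    then show ?thesis
      using surface_measure_small_ball[OF \<sigma>, of U \<psi> x UNIV] by (metis UNIV_I open_UNIV)
  qed
  then obtain V where V: "\<And>p. p \<in> S \<Longrightarrow> openin (top_of_set S) (V p)" "\<And>p. p \<in> S \<Longrightarrow> p \<in> V p"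
      "\<And>p. p \<in> S \<Longrightarrow> emeasure \<sigma> (V p) < \<infinity>"
    by metis
  have "compact S" using S unfolding closed_smooth_surface_def by simp
  then obtain P where P: "finite P" "P \<subseteq> S" "S \<subseteq> (\<Union>p\<in>P. V p)"
  proof -
    have "\<forall>c\<in>V ` S. openin (top_of_set S) c" "S \<subseteq> \<Union> (V ` S)" using V by auto
    then obtain D where "D \<subseteq> V ` S" "finite D" "S \<subseteq> \<Union> D"
      using \<open>compact S\<close> compact_eq_openin_cover[of S] by meson
    then show ?thesis using that by (metis finite_subset_image)
  qed
  have "emeasure \<sigma> (space \<sigma>) \<le> emeasure \<sigma> (\<Union>p\<in>P. V p)"
    by (rule emeasure_mono)
      (use P V(1) surface_measure_openin_sets[OF \<sigma>] in \<open>auto simp: surface_measure_space[OF \<sigma>] intro!: sets.finite_UN\<close>)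
  also have "\<dots> \<le> (\<Sum>p\<in>P. emeasure \<sigma> (V p))"
    by (rule emeasure_subadditive_finite)
      (use P V(1) surface_measure_openin_sets[OF \<sigma>] in auto)
  also have "\<dots> < \<infinity>" using P V(3) by (auto simp: sum_Pinfty less_top[symmetric] subset_iff)
  finally show "emeasure \<sigma> (space \<sigma>) \<noteq> \<infinity>" by simp
qed

lemma surface_measure_integrable:
  fixes f :: "'a::euclidean_space \<Rightarrow> real"
  assumes S: "closed_smooth_surface TYPE('k::finite) S" and \<sigma>: "surface_measure TYPE('k) S \<sigma>"
    and f: "continuous_on S f"
  shows "integrable \<sigma> f"
proof -
  interpret finite_measure \<sigma> by (rule surface_measure_finite[OF S \<sigma>])
  have "compact S" using S unfolding closed_smooth_surface_def by simp
  then have "bounded (f ` S)" using f compact_continuous_image compact_imp_bounded by blast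
  then obtain B where "\<And>x. x \<in> S \<Longrightarrow> norm (f x) \<le> B" by (auto simp: bounded_iff)
  then show ?thesis
    by (intro integrable_const_bound[of _ B] surface_measure_continuous_measurable[OF \<sigma> f] AE_I2)
      (simp add: surface_measure_space[OF \<sigma>])
qed

text \<open>If \<open>f p\<close> were nonzero, continuity would make \<open>f\<close> nonzero on a neighbourhood of \<open>p\<close>, which has
  positive measure. This turns almost everywhere statements about continuous functions into
  statements about point values, and so makes the mass matrix definite.\<close>

lemma surface_measure_full_support:
  fixes f :: "'a::euclidean_space \<Rightarrow> real"
  assumes S: "closed_smooth_surface TYPE('k::finite) S" and \<sigma>: "surface_measure TYPE('k) S \<sigma>"
    and f: "continuous_on S f" "AE x in \<sigma>. f x = 0" and p: "p \<in> S"
  shows "f p = 0"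
proof (rule ccontr)
  assume "f p \<noteq> 0"
  have "openin (top_of_set S) (S \<inter> f -` (- {0}))"
    by (rule continuous_openin_preimage_gen[OF f(1)]) auto
  then obtain W where W: "open W" "S \<inter> f -` (- {0}) = S \<inter> W" by (auto simp: openin_open)
  obtain U and \<psi> :: "real ^ 'k \<Rightarrow> 'a" and x where ch: "surface_chart S U \<psi>" "x \<in> U" "p = \<psi> x"
    using S p unfolding closed_smooth_surface_def by blast
  have "\<psi> x \<in> W" using W(2) p ch(3) \<open>f p \<noteq> 0\<close> by auto
  from surface_measure_small_ball[OF \<sigma> ch(1,2) W(1) this]
  obtain V where V: "openin (top_of_set S) V" "V \<subseteq> W" "0 < emeasure \<sigma> V" by metis
  have "V \<subseteq> {x \<in> space \<sigma>. f x \<noteq> 0}"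
    using V(2) W(2) openin_imp_subset[OF V(1)] surface_measure_space[OF \<sigma>] by blast
  moreover have "{x \<in> space \<sigma>. f x \<noteq> 0} \<in> null_sets \<sigma>"
    using f(2) surface_measure_continuous_measurable[OF \<sigma> f(1)]
    by (simp add: AE_iff_null)
  ultimately have "emeasure \<sigma> V = 0"
    using emeasure_eq_0 by blast
  then show False using V(3) by simp
qed

section \<open>Continuity of the surface gradient\<close>

lemma smooth_gradient_tangential:
  assumes S: "closed_smooth_surface TYPE('k::finite) S" "p \<in> S" and f: "smooth_fun_on S f"
    and F: "(F has_derivative F') (at p)" and V: "open V" "p \<in> V" "\<And>q. q \<in> S \<inter> V \<Longrightarrow> F q = f q"
    and v: "v \<in> tangent_space S p"
  shows "smooth_gradient S f p \<bullet> v = F' v"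
proof -
  obtain d where d: "d > 0" "ball p d \<subseteq> V"
    using V(1,2) open_contains_ball by blast
  have "(f has_derivative F') (at p within S)"
    by (rule has_derivative_transform_within[OF has_derivative_at_withinI[OF F] d(1) S(2)])
      (use V(3) d(2) in \<open>auto simp: subset_iff dist_commute\<close>)
  moreover obtain \<gamma> where \<gamma>: "\<forall>t. \<gamma> t \<in> S" "\<gamma> 0 = p" "(\<gamma> has_vector_derivative v) (at 0)"
    using v unfolding tangent_space_def by blast
  ultimately show ?thesis
    using chain_tangent_curve[OF \<gamma>] smooth_gradient_works(2)[OF S f] vector_derivative_unique_at by blast
qed

text \<open>In a chart, the coordinates of the gradient of \<open>f\<close> solve the linear system whose matrix is the metric tensor and
  whose right-hand side consists of the partial derivatives of \<open>f\<close>, and Cramer's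
  rule displays the solution as a continuous function. Continuity is used to make the
  gradient measurable, without which the triangle inequality for upper bounds of nonnegative
  integrals may fail.\<close>

lemma smooth_gradient_continuous:
  assumes S: "closed_smooth_surface TYPE('k::finite) S" and f: "smooth_fun_on S f"
  shows "continuous_on S (smooth_gradient S f)"
proof (rule continuous_on_locally)
  fix p assume p: "p \<in> S"
  obtain U and \<psi> :: "real ^ 'k \<Rightarrow> 'a" and x0 where ch: "surface_chart S U \<psi>" and x0: "x0 \<in> U" "p = \<psi> x0"
    using S p unfolding closed_smooth_surface_def by blast
  obtain V F where F: "open V" "p \<in> V" "smooth_on V F" "\<forall>q\<in>S \<inter> V. F q = f q"
    using f p unfolding smooth_fun_on_def by blast
  have sm: "smooth_on U \<psi>" and oU: "open U" and sub: "\<psi> ` U \<subseteq> S"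
    using ch openin_imp_subset unfolding surface_chart_def by blast+
  obtain \<psi>' where hom: "homeomorphism U (\<psi> ` U) \<psi> \<psi>'"
    using ch unfolding surface_chart_def by blast
  define U' where "U' = U \<inter> \<psi> -` V"
  have oU': "open U'"
    unfolding U'_def by (rule continuous_open_preimage[OF smooth_on_imp(1)[OF sm] oU F(1)])
  let ?e = "\<lambda>i x. frechet_derivative \<psi> (at x) (axis i 1)"
  let ?M = "\<lambda>x. metric_tensor \<psi> x"
  define r where "r i x = (\<Sum>b\<in>Basis. (?e i x \<bullet> b) * frechet_derivative F (at (\<psi> x)) b)" for i x
  define w where "w k x = det (\<chi> i j. if j = k then r i x else ?M x $ i $ j) / det (?M x)" for k x
  have cU: "continuous_on U' \<psi>" "\<And>i. continuous_on U' (?e i)" "\<And>i j. continuous_on U' (\<lambda>x. ?M x $ i $ j)"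
    "continuous_on U' (\<lambda>x. det (?M x))"
    using smooth_on_imp(1,3)[OF sm] continuous_on_metric_tensor[OF ch] continuous_on_det_metric_tensor[OF ch]
      continuous_on_subset[of U _ U'] unfolding U'_def by blast+
  have cr: "continuous_on U' (r i)" for i
    unfolding r_def
  proof (intro continuous_intros cU)
    fix b
    show "continuous_on U' (\<lambda>x. frechet_derivative F (at (\<psi> x)) b)"
      by (rule continuous_on_compose2[OF smooth_on_imp(3)[OF F(3)] cU(1)]) (auto simp: U'_def)
  qed
  have cw: "continuous_on U' (w k)" for k
  proof -
    have "continuous_on U' (\<lambda>x. det (\<chi> i j. if j = k then r i x else ?M x $ i $ j))"
      unfolding det_def vec_lambda_beta
    proof (intro continuous_intros)
      show "continuous_on U' (\<lambda>x. if q i = k then r i x else ?M x $ i $ q i)" for q :: "'k \<Rightarrow> 'k" and i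
        by (cases "q i = k") (simp_all add: cr cU)
    qed
    moreover have "\<forall>x\<in>U'. det (?M x) \<noteq> 0"
      using det_metric_tensor_pos[OF ch] by (auto simp: U'_def order_less_le)
    ultimately show ?thesis unfolding w_def using cU(4) by (intro continuous_on_divide)
  qed
  have eq: "smooth_gradient S f (\<psi> x) = (\<Sum>i\<in>UNIV. w i x *\<^sub>R ?e i x)" if x: "x \<in> U'" for x
  proof -
    have xU: "x \<in> U" and xV: "\<psi> x \<in> V" and xS: "\<psi> x \<in> S" using x sub by (auto simp: U'_def)
    let ?g = "smooth_gradient S f (\<psi> x)"
    have F': "(F has_derivative frechet_derivative F (at (\<psi> x))) (at (\<psi> x))"
      using smooth_on_imp(2)[OF F(3) xV] .
    obtain y where y: "?g = frechet_derivative \<psi> (at x) y"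
      using smooth_gradient_works(1)[OF S xS f] tangent_space_chart[OF ch xU] by auto
    have "?g \<bullet> ?e i x = r i x" for i
    proof -
      have "?g \<bullet> ?e i x = frechet_derivative F (at (\<psi> x)) (?e i x)"
        by (rule smooth_gradient_tangential[OF S xS f F' F(1) xV])
          (use F(4) chart_curve_tangent[OF ch xU] in auto)
      also have "\<dots> = frechet_derivative F (at (\<psi> x)) (\<Sum>b\<in>Basis. (?e i x \<bullet> b) *\<^sub>R b)"
        by (simp add: euclidean_representation)
      also have "\<dots> = r i x"
        unfolding r_def using has_derivative_linear[OF F']
        by (simp add: linear_sum linear_cmul)
      finally show ?thesis .
    qed
    then have "?M x *v y = (\<chi> i. r i x)"
      by (simp add: vec_eq_iff metric_tensor_mult[OF ch xU] y[symmetric] inner_commute)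
    then have "y = (\<chi> k. w k x)"
      using cramer[of "?M x" y "\<chi> i. r i x"] det_metric_tensor_pos[OF ch xU]
      unfolding w_def vec_lambda_beta by simp
    then show ?thesis
      using y frechet_derivative_chart_expand[OF ch xU, of y] by simp
  qed
  have "continuous_on U' (\<lambda>x. \<Sum>i\<in>UNIV. w i x *\<^sub>R ?e i x)"
    by (intro continuous_intros cw cU)
  then have cg: "continuous_on U' (\<lambda>x. smooth_gradient S f (\<psi> x))"
    by (rule continuous_on_eq) (simp add: eq)
  have c\<psi>': "continuous_on (\<psi> ` U') \<psi>'"
    using homeomorphism_cont2[OF hom] by (rule continuous_on_subset) (auto simp: U'_def)
  have inv: "\<psi>' (\<psi> x) = x" if "x \<in> U'" for x
    using homeomorphism_apply1[OF hom] that by (auto simp: U'_def)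
  have "\<psi>' ` \<psi> ` U' \<subseteq> U'" using inv by auto
  then have "continuous_on (\<psi> ` U') (\<lambda>q. smooth_gradient S f (\<psi> (\<psi>' q)))"
    by (rule continuous_on_compose2[OF cg c\<psi>'])
  then have "continuous_on (\<psi> ` U') (smooth_gradient S f)"
    by (rule continuous_on_eq) (metis imageE inv)
  moreover have "openin (top_of_set S) (\<psi> ` U')"
    by (rule surface_chart_openin_image[OF ch oU']) (auto simp: U'_def)
  moreover have "p \<in> \<psi> ` U'" using x0 F(2) by (auto simp: U'_def)
  ultimately show "\<exists>N. openin (top_of_set S) N \<and> p \<in> N \<and> continuous_on N (smooth_gradient S f)"
    by blast
qed

section \<open>Linearity of first-order Sobolev spaces\<close>

lemma square_integrable_mult:
  assumes "square_integrable \<sigma> f" "square_integrable \<sigma> g"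
  shows "integrable \<sigma> (\<lambda>x. f x * g x)"
proof (rule Bochner_Integration.integrable_bound[where f = "\<lambda>x. (f x)\<^sup>2 + (g x)\<^sup>2"])
  show "AE x in \<sigma>. norm (f x * g x) \<le> norm ((f x)\<^sup>2 + (g x)\<^sup>2)"
  proof (rule AE_I2)
    fix x
    have "2 * \<bar>f x\<bar> * \<bar>g x\<bar> \<le> (f x)\<^sup>2 + (g x)\<^sup>2"
      using sum_squares_bound[of "\<bar>f x\<bar>" "\<bar>g x\<bar>"] by simp
    moreover have "0 \<le> \<bar>f x\<bar> * \<bar>g x\<bar>" by simp
    ultimately have "\<bar>f x\<bar> * \<bar>g x\<bar> \<le> (f x)\<^sup>2 + (g x)\<^sup>2" by linarith
    then show "norm (f x * g x) \<le> norm ((f x)\<^sup>2 + (g x)\<^sup>2)"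
      by (simp add: abs_mult)
  qed
qed (use assms in \<open>auto simp: square_integrable_def\<close>)

lemma square_integrable_add_scale:
  assumes "square_integrable \<sigma> f" "square_integrable \<sigma> g"
  shows "square_integrable \<sigma> (\<lambda>x. f x + c * g x)"
proof -
  have "integrable \<sigma> (\<lambda>x. (f x)\<^sup>2 + (2 * c) * (f x * g x) + c\<^sup>2 * (g x)\<^sup>2)"
    using assms square_integrable_mult[OF assms] by (auto simp: square_integrable_def)
  moreover have "(\<lambda>x. f x + c * g x) \<in> borel_measurable \<sigma>"
    using assms by (auto simp: square_integrable_def)
  ultimately show ?thesis
    by (simp add: square_integrable_def power2_eq_square algebra_simps)
qed

lemma multi_indices_1_cases:
  assumes "vs \<in> multi_indices 1"
  obtains "vs = []" | b where "b \<in> Basis" "vs = [b]"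
  using assms by (cases vs) (auto simp: multi_indices_def)

lemma cov_deriv_Nil: "cov_deriv S f [] = f"
  by (simp add: fun_eq_iff)

lemma cov_deriv_continuous:
  assumes "closed_smooth_surface TYPE('k::finite) S" "smooth_fun_on S f" "vs \<in> multi_indices 1"
  shows "continuous_on S (cov_deriv S f vs)"
  using assms(3)
proof (cases rule: multi_indices_1_cases)
  case 1
  then show ?thesis using smooth_fun_on_continuous[OF assms(2)] by (simp add: cov_deriv_Nil)
next
  case (2 b)
  have "cov_deriv S f [b] = (\<lambda>p. smooth_gradient S f p \<bullet> b)" by (simp add: fun_eq_iff cov_deriv_Nil)
  then show ?thesis
    using smooth_gradient_continuous[OF assms(1,2)] 2 by (auto intro!: continuous_intros)
qed

text \<open>Linearity is established up to first order because the stiffness matrix sees functions through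
  \<open>W\<^sub>2\<^sup>1(S)\<close>, even though the kernel reproduces \<open>W\<^sub>2\<^sup>m(S)\<close>.\<close>

lemma cov_deriv_add_scale:
  assumes S: "closed_smooth_surface TYPE('k::finite) S" "p \<in> S" and f: "smooth_fun_on S f" "smooth_fun_on S g"
    and vs: "vs \<in> multi_indices 1"
  shows "cov_deriv S (\<lambda>x. f x + c * g x) vs p = cov_deriv S f vs p + c * cov_deriv S g vs p"
  using vs
  by (cases rule: multi_indices_1_cases) (simp_all add: cov_deriv_Nil smooth_gradient_add_scale[OF S f] inner_add_left)

text \<open>The approximating smooth sequences are combined in the same way as the functions; the squared errors satisfy
  \<open>(d + c e)\<^sup>2 \<le> 2 d\<^sup>2 + 2 c\<^sup>2 e\<^sup>2\<close>. Splitting the integral of the right-hand side uses measurability of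
  the covariant derivatives.\<close>

lemma has_weak_cov_derivs_add_scale:
  assumes S: "closed_smooth_surface TYPE('k::finite) S" and \<sigma>: "surface_measure TYPE('k) S \<sigma>"
    and f: "has_weak_cov_derivs S \<sigma> 1 f D" and g: "has_weak_cov_derivs S \<sigma> 1 g E"
  shows "has_weak_cov_derivs S \<sigma> 1 (\<lambda>x. f x + c * g x) (\<lambda>vs x. D vs x + c * E vs x)"
proof -
  obtain F where F: "\<And>n. smooth_fun_on S (F n)"
    "\<And>vs. vs \<in> multi_indices 1 \<Longrightarrow>
      (\<lambda>n. \<integral>\<^sup>+x. ennreal ((cov_deriv S (F n) vs x - D vs x)\<^sup>2) \<partial>\<sigma>) \<longlonglongrightarrow> 0"
    using f unfolding has_weak_cov_derivs_def by blast
  obtain H where H: "\<And>n. smooth_fun_on S (H n)"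
    "\<And>vs. vs \<in> multi_indices 1 \<Longrightarrow>
      (\<lambda>n. \<integral>\<^sup>+x. ennreal ((cov_deriv S (H n) vs x - E vs x)\<^sup>2) \<partial>\<sigma>) \<longlonglongrightarrow> 0"
    using g unfolding has_weak_cov_derivs_def by blast
  have conv: "(\<lambda>n. \<integral>\<^sup>+x. ennreal ((cov_deriv S (\<lambda>x. F n x + c * H n x) vs x - (D vs x + c * E vs x))\<^sup>2) \<partial>\<sigma>) \<longlonglongrightarrow> 0"
    if vs: "vs \<in> multi_indices 1" for vs
  proof (rule tendsto_sandwich[OF _ _ tendsto_const])
    let ?d = "\<lambda>n x. cov_deriv S (F n) vs x - D vs x" and ?e = "\<lambda>n x. cov_deriv S (H n) vs x - E vs x"
    let ?u = "\<lambda>n. ennreal 2 * (\<integral>\<^sup>+x. ennreal ((?d n x)\<^sup>2) \<partial>\<sigma>) + ennreal (2 * c\<^sup>2) * (\<integral>\<^sup>+x. ennreal ((?e n x)\<^sup>2) \<partial>\<sigma>)"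
    have meas: "?d n \<in> borel_measurable \<sigma>" "?e n \<in> borel_measurable \<sigma>" for n
    proof -
      have "D vs \<in> borel_measurable \<sigma>" "E vs \<in> borel_measurable \<sigma>"
        using f g vs unfolding has_weak_cov_derivs_def square_integrable_def by blast+
      then show "?d n \<in> borel_measurable \<sigma>" "?e n \<in> borel_measurable \<sigma>"
        using surface_measure_continuous_measurable[OF \<sigma> cov_deriv_continuous[OF S F(1) vs]]
          surface_measure_continuous_measurable[OF \<sigma> cov_deriv_continuous[OF S H(1) vs]]
        by (auto intro!: borel_measurable_diff)
    qed
    have "(\<integral>\<^sup>+x. ennreal ((cov_deriv S (\<lambda>x. F n x + c * H n x) vs x - (D vs x + c * E vs x))\<^sup>2) \<partial>\<sigma>) \<le> ?u n" for n
    proof -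
      have "(\<integral>\<^sup>+x. ennreal ((cov_deriv S (\<lambda>x. F n x + c * H n x) vs x - (D vs x + c * E vs x))\<^sup>2) \<partial>\<sigma>)
          \<le> (\<integral>\<^sup>+x. ennreal 2 * ennreal ((?d n x)\<^sup>2) + ennreal (2 * c\<^sup>2) * ennreal ((?e n x)\<^sup>2) \<partial>\<sigma>)"
      proof (rule nn_integral_mono)
        fix x assume "x \<in> space \<sigma>"
        then have "x \<in> S" by (simp add: surface_measure_space[OF \<sigma>])
        have err: "cov_deriv S (\<lambda>x. F n x + c * H n x) vs x - (D vs x + c * E vs x) = ?d n x + c * ?e n x"
          using cov_deriv_add_scale[OF S \<open>x \<in> S\<close> F(1) H(1) vs] by (simp add: algebra_simps)
        have le: "(?d n x + c * ?e n x)\<^sup>2 \<le> 2 * (?d n x)\<^sup>2 + 2 * c\<^sup>2 * (?e n x)\<^sup>2"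
          using sum_squares_bound[of "?d n x" "c * ?e n x"]
          by (simp add: power2_sum power_mult_distrib)
        have split: "ennreal 2 * ennreal q + ennreal (2 * c\<^sup>2) * ennreal t = ennreal (2 * q + 2 * c\<^sup>2 * t)"
          if "q \<ge> 0" "t \<ge> 0" for q t
          using that by (subst ennreal_plus) (simp_all add: ennreal_mult)
        show "ennreal ((cov_deriv S (\<lambda>x. F n x + c * H n x) vs x - (D vs x + c * E vs x))\<^sup>2)
          \<le> ennreal 2 * ennreal ((?d n x)\<^sup>2) + ennreal (2 * c\<^sup>2) * ennreal ((?e n x)\<^sup>2)"
          unfolding err split[OF zero_le_power2 zero_le_power2] by (rule ennreal_leI[OF le])
      qed
      also have "\<dots> = ?u n"
        using meas by (subst nn_integral_add) (auto simp: nn_integral_cmult)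
      finally show ?thesis .
    qed
    then show "\<forall>\<^sub>F n in sequentially. (\<integral>\<^sup>+x. ennreal ((cov_deriv S (\<lambda>x. F n x + c * H n x) vs x - (D vs x + c * E vs x))\<^sup>2) \<partial>\<sigma>) \<le> ?u n"
      by simp
    have "?u \<longlonglongrightarrow> ennreal 2 * 0 + ennreal (2 * c\<^sup>2) * 0"
      by (intro tendsto_add ennreal_tendsto_cmult F(2) H(2) vs) auto
    then show "?u \<longlonglongrightarrow> 0" by simp
  qed simp
  have "AE x in \<sigma>. D [] x + c * E [] x = f x + c * g x"
    using f g unfolding has_weak_cov_derivs_def by auto
  moreover have "square_integrable \<sigma> (\<lambda>x. f x + c * g x)"
    "\<forall>vs\<in>multi_indices 1. square_integrable \<sigma> (\<lambda>x. D vs x + c * E vs x)"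
    using f g unfolding has_weak_cov_derivs_def by (auto intro!: square_integrable_add_scale)
  ultimately show ?thesis
    unfolding has_weak_cov_derivs_def
    using conv smooth_fun_on_add_scale[OF F(1) H(1)]
    by (intro conjI exI[of _ "\<lambda>n x. F n x + c * H n x"]) auto
qed

lemma sobolev_space_add_scale:
  assumes "closed_smooth_surface TYPE('k::finite) S" "surface_measure TYPE('k) S \<sigma>"
    and "f \<in> sobolev_space S \<sigma> 1" "g \<in> sobolev_space S \<sigma> 1"
  shows "(\<lambda>x. f x + c * g x) \<in> sobolev_space S \<sigma> 1"
  using assms has_weak_cov_derivs_add_scale[OF assms(1,2)] unfolding sobolev_space_def by blast

lemma sobolev_space_zero:
  assumes S: "closed_smooth_surface TYPE('k::finite) S" and \<sigma>: "surface_measure TYPE('k) S \<sigma>"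
  shows "(\<lambda>_. 0) \<in> sobolev_space S \<sigma> 1"
proof -
  have 0: "cov_deriv S (\<lambda>_. 0) vs x = 0" if "vs \<in> multi_indices 1" "x \<in> S" for vs x
    using that(1) by (cases rule: multi_indices_1_cases) (simp_all add: cov_deriv_Nil smooth_gradient_zero[OF S that(2)])
  have "(\<integral>\<^sup>+x. ennreal ((cov_deriv S (\<lambda>_. 0) vs x - 0)\<^sup>2) \<partial>\<sigma>) = (\<integral>\<^sup>+x. 0 \<partial>\<sigma>)"
    if "vs \<in> multi_indices 1" for vs
    by (rule nn_integral_cong) (simp add: 0[OF that] surface_measure_space[OF \<sigma>])
  then have "has_weak_cov_derivs S \<sigma> 1 (\<lambda>_. 0) (\<lambda>_ _. 0)"
    unfolding has_weak_cov_derivs_def square_integrable_def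
    using smooth_fun_on_zero by (intro conjI exI[of _ "\<lambda>_ _. 0"]) auto
  then show ?thesis unfolding sobolev_space_def by blast
qed

lemma sobolev_space_sum:
  assumes S: "closed_smooth_surface TYPE('k::finite) S" and \<sigma>: "surface_measure TYPE('k) S \<sigma>"
    and "finite J" "\<And>j. j \<in> J \<Longrightarrow> f j \<in> sobolev_space S \<sigma> 1"
  shows "(\<lambda>x. \<Sum>j\<in>J. c j * f j x) \<in> sobolev_space S \<sigma> 1"
  using assms(3,4)
proof (induction J)
  case empty
  then show ?case using sobolev_space_zero[OF S \<sigma>] by simp
next
  case (insert j J)
  then have "(\<lambda>x. (\<Sum>j\<in>J. c j * f j x) + c j * f j x) \<in> sobolev_space S \<sigma> 1"
    by (intro sobolev_space_add_scale[OF S \<sigma>]) auto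
  then show ?case using insert by (simp add: add.commute)
qed

lemma sobolev_space_antimono:
  assumes "m \<le> n"
  shows "sobolev_space S \<sigma> n \<subseteq> sobolev_space S \<sigma> m"
proof -
  have "multi_indices m \<subseteq> (multi_indices n :: 'a list set)" using assms by (auto simp: multi_indices_def)
  then have "has_weak_cov_derivs S \<sigma> n f D \<Longrightarrow> has_weak_cov_derivs S \<sigma> m f D" for f D
    unfolding has_weak_cov_derivs_def by blast
  then show ?thesis unfolding sobolev_space_def by blast
qed

lemma sobolev_space_cong:
  assumes \<sigma>: "surface_measure TYPE('k::finite) S \<sigma>" and "f \<in> sobolev_space S \<sigma> m" "\<And>x. x \<in> S \<Longrightarrow> g x = f x"
  shows "g \<in> sobolev_space S \<sigma> m"
proof -
  have eq: "x \<in> space \<sigma> \<Longrightarrow> g x = f x" for x using assms(3) surface_measure_space[OF \<sigma>] by simp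
  have "square_integrable \<sigma> g = square_integrable \<sigma> f"
    unfolding square_integrable_def
    using measurable_cong[of \<sigma> g f borel, OF eq] Bochner_Integration.integrable_cong[of \<sigma> \<sigma> "\<lambda>x. (g x)\<^sup>2" "\<lambda>x. (f x)\<^sup>2"] eq
    by auto
  moreover have "(AE x in \<sigma>. D x = g x) = (AE x in \<sigma>. D x = f x)" for D
    by (rule AE_cong) (simp add: eq)
  ultimately show ?thesis
    using assms(2) unfolding sobolev_space_def has_weak_cov_derivs_def by simp
qed

text \<open>This is where membership in the Sobolev space enters: the gradient is built from an
  arbitrarily chosen weak derivative, and the choice is meaningful only if one exists.\<close>

lemma sobolev_space_surface_gradient:
  assumes "f \<in> sobolev_space S \<sigma> 1" "g \<in> sobolev_space S \<sigma> 1"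
  shows "integrable \<sigma> (\<lambda>x. surface_gradient S \<sigma> f x \<bullet> surface_gradient S \<sigma> g x)"
proof -
  have sq: "square_integrable \<sigma> (weak_cov_deriv S \<sigma> 1 h [b])" if "h \<in> sobolev_space S \<sigma> 1" "b \<in> Basis" for h b
  proof -
    have "\<exists>D. has_weak_cov_derivs S \<sigma> 1 h D"
      using that(1) by (simp add: sobolev_space_def)
    then have "has_weak_cov_derivs S \<sigma> 1 h (weak_cov_deriv S \<sigma> 1 h)"
      unfolding weak_cov_deriv_def by (rule someI_ex)
    then show ?thesis using that(2) by (auto simp: has_weak_cov_derivs_def multi_indices_def)
  qed
  have "surface_gradient S \<sigma> f x \<bullet> surface_gradient S \<sigma> g x =
      (\<Sum>b\<in>Basis. weak_cov_deriv S \<sigma> 1 f [b] x * weak_cov_deriv S \<sigma> 1 g [b] x)" for x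
    unfolding surface_gradient_def
    by (subst euclidean_inner) (auto simp: inner_sum_left_Basis intro!: sum.cong)
  then show ?thesis
    using sq assms by (auto intro!: Bochner_Integration.integrable_sum square_integrable_mult)
qed

section \<open>Mass and stiffness matrices\<close>

text \<open>The quadratic form of a Gram matrix is a squared norm. Integrability of all products is essential, since
  otherwise entries are the default value \<open>0\<close> and positivity may be lost.\<close>

lemma gram_matrix_quadratic_form:
  fixes f :: "'n::finite \<Rightarrow> 'a \<Rightarrow> 'b::real_inner"
  assumes "\<And>i j. integrable \<sigma> (\<lambda>x. f i x \<bullet> f j x)"
  shows "v \<bullet> ((\<chi> i j. L2_inner \<sigma> (f i) (f j)) *v v)
      = (\<integral>x. (\<Sum>i\<in>UNIV. v $ i *\<^sub>R f i x) \<bullet> (\<Sum>i\<in>UNIV. v $ i *\<^sub>R f i x) \<partial>\<sigma>)"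
proof -
  have "(\<integral>x. (\<Sum>i\<in>UNIV. v $ i *\<^sub>R f i x) \<bullet> (\<Sum>i\<in>UNIV. v $ i *\<^sub>R f i x) \<partial>\<sigma>)
      = (\<integral>x. (\<Sum>i\<in>UNIV. \<Sum>j\<in>UNIV. v $ i * (v $ j * (f i x \<bullet> f j x))) \<partial>\<sigma>)"
    by (simp add: inner_sum_left inner_sum_right mult.left_commute sum_distrib_left inner_commute
         cong: sum.cong)
  also have "\<dots> = (\<Sum>i\<in>UNIV. \<Sum>j\<in>UNIV. v $ i * (v $ j * L2_inner \<sigma> (f i) (f j)))"
    using assms by (simp add: L2_inner_def)
  also have "\<dots> = v \<bullet> ((\<chi> i j. L2_inner \<sigma> (f i) (f j)) *v v)"
    by (simp add: inner_vec_def matrix_vector_mult_def sum_distrib_left mult.commute)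
  finally show ?thesis by simp
qed

lemma mass_matrix_symmetric: "transpose (mass_matrix \<sigma> lag) = mass_matrix \<sigma> lag"
  by (simp add: transpose_def mass_matrix_def L2_inner_def vec_eq_iff mult.commute)

lemma stiffness_matrix_symmetric: "transpose (stiffness_matrix S \<sigma> lag) = stiffness_matrix S \<sigma> lag"
  by (simp add: transpose_def stiffness_matrix_def L2_inner_def vec_eq_iff inner_commute)

lemma stiffness_matrix_nonneg:
  assumes "\<And>i. lag i \<in> sobolev_space S \<sigma> 1"
  shows "v \<bullet> (stiffness_matrix S \<sigma> lag *v v) \<ge> 0"
  unfolding stiffness_matrix_def
  by (subst gram_matrix_quadratic_form) (auto intro!: sobolev_space_surface_gradient assms)

text \<open>A combination of Lagrange functions with vanishing \<open>L\<^sub>2\<close> norm is continuous and zero almost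
  everywhere, hence zero at the nodes, where its values are the coefficients.\<close>

lemma mass_matrix_pos:
  fixes S :: "'a::euclidean_space set"
  assumes S: "closed_smooth_surface TYPE('k::finite) S" and \<sigma>: "surface_measure TYPE('k) S \<sigma>"
    and c: "\<And>i. continuous_on S (lag i)" and z: "range z \<subseteq> S"
    and lag: "\<And>i j. lag i (z j) = (if i = j then 1 else 0)" and "v \<noteq> 0"
  shows "v \<bullet> (mass_matrix \<sigma> lag *v v) > 0"
proof -
  let ?u = "\<lambda>x. \<Sum>i\<in>UNIV. v $ i * lag i x"
  have cu: "continuous_on S ?u" by (intro continuous_intros c)
  have int: "integrable \<sigma> (\<lambda>x. ?u x * ?u x)"
    by (intro surface_measure_integrable[OF S \<sigma>] continuous_intros cu)
  have "v \<bullet> (mass_matrix \<sigma> lag *v v) = (\<integral>x. ?u x * ?u x \<partial>\<sigma>)"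
    unfolding mass_matrix_def
    by (subst gram_matrix_quadratic_form)
      (auto intro!: surface_measure_integrable[OF S \<sigma>] continuous_intros c)
  moreover have "(\<integral>x. ?u x * ?u x \<partial>\<sigma>) \<noteq> 0"
  proof
    assume "(\<integral>x. ?u x * ?u x \<partial>\<sigma>) = 0"
    then have "AE x in \<sigma>. ?u x = 0"
      using integral_nonneg_eq_0_iff_AE[OF int] by simp
    then have "?u (z j) = 0" for j
      using surface_measure_full_support[OF S \<sigma> cu, of "z j"] z by blast
    moreover have "?u (z j) = v $ j" for j by (simp add: lag if_distrib cong: if_cong)
    ultimately show False using \<open>v \<noteq> 0\<close> by (simp add: vec_eq_iff)
  qed
  moreover have "(\<integral>x. ?u x * ?u x \<partial>\<sigma>) \<ge> 0"
    by (rule Bochner_Integration.integral_nonneg) simp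
  ultimately show ?thesis by linarith
qed

section \<open>Energy balance\<close>

text \<open>The fundamental theorem of calculus along the segment from \<open>a\<close> to \<open>b\<close>. The product form also covers \<open>a = b\<close>.\<close>

lemma avg_slope_mult:
  assumes "\<And>u. (G has_real_derivative G' u) (at u)"
  shows "avg_slope G' a b * (b - a) = G b - G a"
proof -
  have "((\<lambda>s. G' ((1 - s) * a + s * b) * (b - a)) has_integral (G ((1 - 1) * a + 1 * b) - G ((1 - 0) * a + 0 * b))) {0..1}"
  proof (rule fundamental_theorem_of_calculus[where f = "\<lambda>s. G ((1 - s) * a + s * b)"])
    fix s :: real
    have "((\<lambda>s. (1 - s) * a + s * b) has_real_derivative (b - a)) (at s within {0..1})"
      by (auto intro!: derivative_eq_intros)
    from DERIV_chain2[OF assms this]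
    have "((\<lambda>s. G ((1 - s) * a + s * b)) has_real_derivative G' ((1 - s) * a + s * b) * (b - a)) (at s within {0..1})" .
    then show "((\<lambda>s. G ((1 - s) * a + s * b)) has_vector_derivative G' ((1 - s) * a + s * b) * (b - a)) (at s within {0..1})"
      by (simp add: has_real_derivative_iff_has_vector_derivative)
  qed simp
  from integral_unique[OF this]
  have "integral {0..1} (\<lambda>s. G' ((1 - s) * a + s * b) * (b - a)) = G b - G a"
    by simp
  then show ?thesis unfolding avg_slope_def integral_mult_left .
qed

lemma continuous_on_avg_slope:
  assumes G': "continuous_on UNIV G'" and u: "continuous_on S u" and v: "continuous_on S v"
  shows "continuous_on S (\<lambda>x. avg_slope G' (u x) (v x))"
proof -
  have "continuous_on (S \<times> cbox 0 1) (\<lambda>(x, s). G' ((1 - s) * u x + s * v x))"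
    unfolding split_beta
    by (intro continuous_on_compose2[OF G'] continuous_intros continuous_on_compose2[OF u] continuous_on_compose2[OF v]) auto
  from integral_continuous_on_param[OF this] show ?thesis
    unfolding avg_slope_def by (simp add: box_real)
qed

text \<open>Testing the nonlinear term with the increment of the solution multiplies the averaged slope by
  the increment pointwise, so the integrand telescopes to the exact change of free energy density.
  This is the reason for discretising \<open>G'\<close> by its average.\<close>

lemma nonlinear_vec_inner_increment:
  fixes S :: "'a::euclidean_space set"
  assumes S: "closed_smooth_surface TYPE('k::finite) S" and \<sigma>: "surface_measure TYPE('k) S \<sigma>"
    and c: "\<And>i. continuous_on S (lag i)"
    and G: "\<And>u. (G has_real_derivative G' u) (at u)" and G': "continuous_on UNIV G'"
  shows "(b - a) \<bullet> nonlinear_vec \<sigma> lag G' a b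
    = L2_inner \<sigma> (\<lambda>x. G (discrete_fun lag b x)) (\<lambda>_. 1) - L2_inner \<sigma> (\<lambda>x. G (discrete_fun lag a x)) (\<lambda>_. 1)"
proof -
  let ?u = "\<lambda>a x. discrete_fun lag a x"
  let ?q = "\<lambda>x. avg_slope G' (?u a x) (?u b x)"
  have cu: "continuous_on S (?u a)" for a
    unfolding discrete_fun_def by (intro continuous_intros c)
  have cG: "continuous_on UNIV G"
    using G by (meson DERIV_isCont continuous_at_imp_continuous_on)
  have iG: "integrable \<sigma> (\<lambda>x. G (?u a x))" for a
    by (rule surface_measure_integrable[OF S \<sigma>]) (rule continuous_on_compose2[OF cG cu], simp)
  have iq: "integrable \<sigma> (\<lambda>x. ?q x * lag i x)" for i
    by (rule surface_measure_integrable[OF S \<sigma>]) (intro continuous_intros continuous_on_avg_slope G' cu c)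
  have "(b - a) \<bullet> nonlinear_vec \<sigma> lag G' a b = (\<Sum>i\<in>UNIV. (b - a) $ i * (\<integral>x. ?q x * lag i x \<partial>\<sigma>))"
    by (simp add: inner_vec_def nonlinear_vec_def L2_inner_def)
  also have "\<dots> = (\<integral>x. (\<Sum>i\<in>UNIV. (b - a) $ i * (?q x * lag i x)) \<partial>\<sigma>)"
    using iq by simp
  also have "\<dots> = (\<integral>x. G (?u b x) - G (?u a x) \<partial>\<sigma>)"
  proof (rule Bochner_Integration.integral_cong[OF refl])
    fix x
    have "(\<Sum>i\<in>UNIV. (b - a) $ i * (q * lag i x)) = q * (?u b x - ?u a x)" for q
      by (simp add: discrete_fun_def sum_subtractf[symmetric] sum_distrib_left algebra_simps)
    then show "(\<Sum>i\<in>UNIV. (b - a) $ i * (?q x * lag i x)) = G (?u b x) - G (?u a x)"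
      using avg_slope_mult[OF G] by simp
  qed
  also have "\<dots> = (\<integral>x. G (?u b x) \<partial>\<sigma>) - (\<integral>x. G (?u a x) \<partial>\<sigma>)"
    using iG by simp
  finally show ?thesis by (simp add: L2_inner_def)
qed

text \<open>The discrete chain rule: the averaged nonlinearity and the midpoint in the Dirichlet term
  are chosen so that the energy increment is exactly the increment of the coefficients times
  a discrete chemical potential. For the Dirichlet part it is the identity
  \<open>b\<^sup>2 - a\<^sup>2 = (b - a) (b + a)\<close> for the symmetric form \<open>B\<close>.\<close>

lemma discrete_energy_increment:
  fixes S :: "'a::euclidean_space set"
  assumes S: "closed_smooth_surface TYPE('k::finite) S" and \<sigma>: "surface_measure TYPE('k) S \<sigma>"
    and c: "\<And>i. continuous_on S (lag i)"
    and G: "\<And>u. (G has_real_derivative G' u) (at u)" and G': "continuous_on UNIV G'"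
  defines "B \<equiv> stiffness_matrix S \<sigma> lag"
  shows "discrete_energy S \<sigma> lag G \<epsilon> b - discrete_energy S \<sigma> lag G \<epsilon> a
    = (b - a) \<bullet> (\<epsilon>\<^sup>2 *\<^sub>R (B *v ((a + b) /\<^sub>R 2)) + nonlinear_vec \<sigma> lag G' a b)"
proof -
  have "transpose B = B" by (simp add: B_def stiffness_matrix_symmetric)
  then have "b \<bullet> (B *v a) = a \<bullet> (B *v b)"
    by (metis dot_lmul_matrix inner_commute transpose_matrix_vector)
  then have "(b - a) \<bullet> (B *v ((a + b) /\<^sub>R 2)) = (b \<bullet> (B *v b) - a \<bullet> (B *v a)) / 2"
    by (simp add: matrix_vector_mult_scaleR matrix_vector_right_distrib inner_diff_left inner_add_right)
  then show ?thesis
    using nonlinear_vec_inner_increment[OF S \<sigma> c G G', where a = a and b = b]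
    unfolding discrete_energy_def B_def[symmetric] inner_add_right inner_scaleR_right
    by (simp add: algebra_simps)
qed

text \<open>Kernel functions are continuous and lie in \<open>W\<^sub>2\<^sup>m(S)\<close> by definition of the kernel. Lagrange
  functions agree on \<open>S\<close> with combinations of them, and may be arbitrary outside.\<close>

lemma lagrange_functions_regular:
  fixes S :: "'a::euclidean_space set"
  assumes S: "closed_smooth_surface TYPE('k::finite) S" and \<sigma>: "surface_measure TYPE('k) S \<sigma>"
    and m: "m \<ge> 1" and \<phi>: "matern_kernel S \<sigma> m \<phi>" and z: "range z \<subseteq> S"
    and lag: "lagrange_functions S \<phi> z lag"
  shows "continuous_on S (lag i)" "lag i \<in> sobolev_space S \<sigma> 1"
proof -
  have k: "(\<lambda>x. \<phi> x (z j)) \<in> sobolev_space S \<sigma> m" "continuous_on S (\<lambda>x. \<phi> x (z j))" for j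
    using \<phi> z unfolding matern_kernel_def Let_def by blast+
  obtain c where c: "\<And>x. x \<in> S \<Longrightarrow> lag i x = (\<Sum>j\<in>UNIV. c $ j * \<phi> x (z j))"
    using lag unfolding lagrange_functions_def kernel_space_def by blast
  have "continuous_on S (\<lambda>x. \<Sum>j\<in>UNIV. c $ j * \<phi> x (z j))"
    by (intro continuous_intros k)
  then show "continuous_on S (lag i)"
    by (rule continuous_on_eq) (simp add: c)
  have "(\<lambda>x. \<Sum>j\<in>UNIV. c $ j * \<phi> x (z j)) \<in> sobolev_space S \<sigma> 1"
    using k(1) sobolev_space_antimono[OF m] by (intro sobolev_space_sum[OF S \<sigma>] finite) blast
  then show "lag i \<in> sobolev_space S \<sigma> 1"
    by (rule sobolev_space_cong[OF \<sigma>]) (rule c)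
qed

theorem theorem4p1:
  fixes S :: "'a::euclidean_space set"
    and \<sigma> :: "'a measure"
    and m :: nat
    and \<phi> :: "'a \<Rightarrow> 'a \<Rightarrow> real"
    and z :: "'n::finite \<Rightarrow> 'a"
    and lag :: "'n \<Rightarrow> 'a \<Rightarrow> real"
    and G G' :: "real \<Rightarrow> real"
    and \<epsilon> T :: real
    and Nt :: nat
    and \<alpha> :: "nat \<Rightarrow> real ^ 'n"
  assumes "closed_smooth_surface TYPE('k::finite) S"
    and "surface_measure TYPE('k) S \<sigma>"
    and "2 * m > CARD('k)"
    and "matern_kernel S \<sigma> m \<phi>"
    and "inj z" and "range z \<subseteq> S"
    and "lagrange_functions S \<phi> z lag"
    and "\<And>u. (G has_real_derivative G' u) (at u)"
    and "smooth_on UNIV G'"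
    and "\<epsilon> > 0" and "T > 0" and "Nt > 0"
    and "(\<forall>n<Nt. allen_cahn_step S \<sigma> lag G' \<epsilon> (T / real Nt) (\<alpha> n) (\<alpha> (n + 1))) \<or>
         (\<forall>n<Nt. cahn_hilliard_step S \<sigma> lag G' \<epsilon> (T / real Nt) (\<alpha> n) (\<alpha> (n + 1)))"
  shows "\<forall>n\<in>{1..Nt}. discrete_energy S \<sigma> lag G \<epsilon> (\<alpha> n) \<le> discrete_energy S \<sigma> lag G \<epsilon> (\<alpha> (n - 1))"
proof
  fix n assume "n \<in> {1..Nt}"
  have m: "m \<ge> 1" using assms(3) by (cases m) auto
  note regular = lagrange_functions_regular[OF assms(1,2) m assms(4,6,7)]
  define A where "A = mass_matrix \<sigma> lag"
  define B where "B = stiffness_matrix S \<sigma> lag"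
  define a where "a = \<alpha> (n - 1)"
  define b where "b = \<alpha> n"
  define dt where "dt = T / real Nt"
  \<comment> \<open>\<open>w\<close> lists the discrete chemical potential tested against the Lagrange functions, and \<open>y\<close> is
    its coefficient vector in the Lagrange basis.\<close>
  define w where "w = \<epsilon>\<^sup>2 *\<^sub>R (B *v ((a + b) /\<^sub>R 2)) + nonlinear_vec \<sigma> lag G' a b"
  define y where "y = matrix_inv A *v w"
  have dt: "dt > 0" using assms(11,12) by (simp add: dt_def)
  have A_pos: "v \<bullet> (A *v v) > 0" if "v \<noteq> 0" for v
    unfolding A_def
    by (rule mass_matrix_pos[OF assms(1,2) regular(1) assms(6) _ that])
      (use assms(7) in \<open>auto simp: lagrange_functions_def\<close>)
  have B_nonneg: "v \<bullet> (B *v v) \<ge> 0" for v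
    unfolding B_def by (rule stiffness_matrix_nonneg) (rule regular(2))
  have "A ** matrix_inv A = mat 1"
    using someI_ex[OF pos_def_invertible[OF A_pos, unfolded invertible_def]]
    unfolding matrix_inv_def by blast
  then have A_inv: "A *v (matrix_inv A *v u) = u" for u
    by (simp add: matrix_vector_mul_assoc)
  have Ay: "A *v y = w"
    by (simp add: y_def A_inv)
  have increment: "b - a = - (dt *\<^sub>R u)" if "(b - a) /\<^sub>R dt = - u" for u
  proof -
    have "b - a = dt *\<^sub>R ((b - a) /\<^sub>R dt)" using dt by simp
    then show ?thesis by (simp only: that scaleR_minus_right)
  qed
  have "allen_cahn_step S \<sigma> lag G' \<epsilon> dt a b \<or> cahn_hilliard_step S \<sigma> lag G' \<epsilon> dt a b"
  proof -
    have "n - 1 < Nt" "n - 1 + 1 = n" using \<open>n \<in> {1..Nt}\<close> by auto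
    then show ?thesis using assms(13) unfolding a_def b_def dt_def by metis
  qed
  then have "(b - a) \<bullet> w \<le> 0"
  proof
    assume "allen_cahn_step S \<sigma> lag G' \<epsilon> dt a b"
    then have "(b - a) /\<^sub>R dt = - y"
      unfolding allen_cahn_step_def Let_def A_def[symmetric] B_def[symmetric] y_def w_def
      by (simp add: matrix_vector_right_distrib matrix_vector_mult_scaleR matrix_vector_mul_assoc)
    then have "b - a = - (dt *\<^sub>R y)"
      by (rule increment)
    moreover have "0 \<le> y \<bullet> (A *v y)" using A_pos[of y] by (cases "y = 0") auto
    ultimately show ?thesis using dt Ay by simp
  next
    assume "cahn_hilliard_step S \<sigma> lag G' \<epsilon> dt a b"
    then have "(b - a) /\<^sub>R dt = - (matrix_inv A *v (B *v y))"
      unfolding cahn_hilliard_step_def Let_def A_def[symmetric] B_def[symmetric] y_def w_def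
      by (simp add: matrix_vector_right_distrib matrix_vector_mult_scaleR matrix_vector_mul_assoc matrix_mul_assoc)
    then have "b - a = - (dt *\<^sub>R (matrix_inv A *v (B *v y)))"
      by (rule increment)
    \<comment> \<open>By symmetry, the mass matrix moves to the other factor and cancels its inverse.\<close>
    moreover have "(matrix_inv A *v (B *v y)) \<bullet> (A *v y) = y \<bullet> (B *v y)"
    proof -
      have "(matrix_inv A *v (B *v y)) \<bullet> (A *v y) = (A *v (matrix_inv A *v (B *v y))) \<bullet> y"
        using mass_matrix_symmetric[of \<sigma> lag] unfolding A_def[symmetric]
        by (metis dot_lmul_matrix transpose_matrix_vector)
      also have "\<dots> = y \<bullet> (B *v y)"
        by (simp add: A_inv inner_commute)
      finally show ?thesis .
    qed
    ultimately show ?thesis using dt B_nonneg[of y] Ay by simp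
  qed
  moreover have "discrete_energy S \<sigma> lag G \<epsilon> b - discrete_energy S \<sigma> lag G \<epsilon> a = (b - a) \<bullet> w"
    unfolding w_def B_def
    by (rule discrete_energy_increment[OF assms(1,2) regular(1) assms(8) smooth_on_imp(1)[OF assms(9)]])
  ultimately show "discrete_energy S \<sigma> lag G \<epsilon> (\<alpha> n) \<le> discrete_energy S \<sigma> lag G \<epsilon> (\<alpha> (n - 1))"
    unfolding a_def b_def by simp
qed

end
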